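(* Let $R\geq 1$, $M>1$, let $n\geq 1$ be an integer, let $\hat{x}_0\in\mathbb{S}^2$ and $\delta>0$ be fixed, and let $K>1$. Let $f\in\mathcal{C}_{M,2n+1}$ and let $u\in H^{2n+3}_{loc}(\mathbb{R}^3)$ be the unique radiating solution of $(\Delta+k^2)u=-f$ in $\mathbb{R}^3$, with far-field pattern $u^\infty(\hat{x},k)$. Assume $$\epsilon:=\|u^{\infty}\|_{L^{\infty}(\mathcal{V}_\delta(\hat{x}_0)\times (0,K))}<1.$$ Then there exist $\alpha\in(0,1)$ (depending only on $R$ and $\delta$) and a constant $C>0$ independent of $K$ such that $$\|f\|^2_{L^2(\mathbb{R}^3)}\leq C\left[ K^3e^{2K(1-\alpha)}\epsilon^{2\alpha}+\frac{M^2}{\big(K^{2/3}|\ln\epsilon|^{1/4}\big)^{4n-3}}\right].$$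
   Context: For $R\ge1$, $B_R=B(0,R)=\{x\in\mathbb{R}^3:|x|<R\}$. For $M>1$ and an integer $m\ge1$, $\mathcal{C}_{M,m}=\{f\in H^{m}(\mathbb{R}^3): \|f\|_{H^{m}(\mathbb{R}^3)}\le M,\ \operatorname{supp} f\subset B_R\}$ (complex-valued functions). For $k>0$ and compactly supported $f\in L^2(\mathbb{R}^3)$, $u$ denotes the unique solution of $(\Delta+k^2)u=-f$ in $\mathbb{R}^3$ satisfying the Sommerfeld radiation condition $\lim_{r=|x|\to\infty} r(\partial_r u-iku)=0$, i.e. $u(x)=\int \frac{e^{ik|x-y|}}{4\pi|x-y|}f(y)\,dy$. Its far-field pattern is $u^\infty(\hat{x},k)=\int_{\mathbb{R}^3}e^{-ik\hat{x}\cdot y}f(y)\,dy$ for $\hat{x}\in\mathbb{S}^2$, so $u(x)=\frac{e^{ik|x|}}{4\pi|x|}\{u^\infty(\hat x,k)+O(1/|x|)\}$. For $\hat{x}_0\in\mathbb{S}^2$ and $\delta>0$, $\mathcal{V}_\delta(\hat{x}_0)=\{\hat{x}\in\mathbb{S}^2:|\hat{x}-\hat{x}_0|<\delta\}$. *)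

theory Defs
  imports "HOL-Analysis.Analysis"
begin

definition fourier :: "(real^3 \<Rightarrow> complex) \<Rightarrow> real^3 \<Rightarrow> complex" where
  "fourier f \<xi> = (LINT y|lborel. exp (- \<i> * complex_of_real (\<xi> \<bullet> y)) * f y)"

text \<open>Far-field pattern of the radiating solution of (Delta + k^2) u = - f.\<close>
definition far_field :: "(real^3 \<Rightarrow> complex) \<Rightarrow> real^3 \<Rightarrow> real \<Rightarrow> complex" where
  "far_field f xh k = (LINT y|lborel. exp (- \<i> * complex_of_real (k * (xh \<bullet> y))) * f y)"

definition L2_fun :: "(real^3 \<Rightarrow> complex) \<Rightarrow> bool" where
  "L2_fun f \<longleftrightarrow> f \<in> borel_measurable lborel \<and> integrable lborel (\<lambda>x. (cmod (f x))\<^sup>2)"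

definition L2_norm_sq :: "(real^3 \<Rightarrow> complex) \<Rightarrow> real" where
  "L2_norm_sq f = (LINT x|lborel. (cmod (f x))\<^sup>2)"

definition in_H :: "nat \<Rightarrow> (real^3 \<Rightarrow> complex) \<Rightarrow> bool" where
  "in_H m f \<longleftrightarrow> L2_fun f \<and>
     integrable lborel (\<lambda>\<xi>. (1 + (norm \<xi>)\<^sup>2) ^ m * (cmod (fourier f \<xi>))\<^sup>2)"

definition H_norm :: "nat \<Rightarrow> (real^3 \<Rightarrow> complex) \<Rightarrow> real" where
  "H_norm m f = sqrt ((1 / (2 * pi) ^ 3) *
     (LINT \<xi>|lborel. (1 + (norm \<xi>)\<^sup>2) ^ m * (cmod (fourier f \<xi>))\<^sup>2))"

definition adm_class :: "real \<Rightarrow> real \<Rightarrow> nat \<Rightarrow> (real^3 \<Rightarrow> complex) set" where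
  "adm_class R M m = {f. in_H m f \<and> H_norm m f \<le> M \<and> {x. f x \<noteq> 0} \<subseteq> ball 0 R}"

definition sph_nbhd :: "real^3 \<Rightarrow> real \<Rightarrow> (real^3) set" where
  "sph_nbhd x0 \<delta> = {x \<in> sphere 0 1. norm (x - x0) < \<delta>}"

text \<open>Sup norm of the far field over V_delta(x0) x (0,K) (far field is continuous).\<close>
definition ff_sup :: "(real^3 \<Rightarrow> complex) \<Rightarrow> real^3 \<Rightarrow> real \<Rightarrow> real \<Rightarrow> real" where
  "ff_sup f x0 \<delta> K = (SUP p \<in> sph_nbhd x0 \<delta> \<times> {0<..<K}. cmod (far_field f (fst p) (snd p)))"

end

theory Submission
  imports Defs "HOL-Probability.Probability" "HOL-Real_Asymp.Real_Asymp"
begin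

text \<open>
  The far field is the Fourier transform on the cone over \<open>V_\<delta>(x0)\<close>, and this cone contains a fixed
  ball around \<open>x0 / 2\<close> at frequencies below 1. As \<open>f\<close> is supported in a ball, its transform can be extrapolated from
  there to \<open>norm \<xi> \<le> s\<close> by forward differences with an error of size
  \<open>\<epsilon> exp (O(s ln s)) + exp (- O(s))\<close>; frequencies above \<open>s\<close> are controlled by the Sobolev norm, and
  Plancherel's identity concludes.

  Take \<open>\<alpha> = 1/2\<close>. If \<open>\<bar>ln \<epsilon>\<bar> \<le> K\<close>, the first term of the estimate is at least 1 and the
  trivial bound \<open>M\<^sup>2\<close> suffices. Otherwise \<open>s = K powr (2/3) * \<bar>ln \<epsilon>\<bar> powr (1/4)\<close> is at most
  \<open>\<bar>ln \<epsilon>\<bar> powr (11/12)\<close>, so that \<open>\<epsilon>\<close> beats \<open>exp (O(s ln s))\<close>. For \<open>\<epsilon> = 0\<close>, where the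
  right-hand side is 0 because \<open>ln 0 = 0\<close> and \<open>x / 0 = 0\<close>, let \<open>s\<close> tend to infinity.
\<close>

section \<open>Gaussian integrals\<close>

text \<open>Lebesgue measure on a Euclidean space is the image of a finite product of copies of the
  one on the line, so the product form of Fubini's theorem carries over.\<close>

lemma
  fixes f :: "'a::euclidean_space \<Rightarrow> real \<Rightarrow> complex"
  assumes "\<And>b. b \<in> Basis \<Longrightarrow> integrable lborel (f b)"
  shows integrable_lborel_prod: "integrable lborel (\<lambda>x::'a. \<Prod>b\<in>Basis. f b (x \<bullet> b))"
    and integral_lborel_prod:
      "(LINT x|lborel. (\<Prod>b\<in>Basis. f b ((x::'a) \<bullet> b))) = (\<Prod>b\<in>Basis. LINT t|lborel. f b t)"
proof -
  interpret product_sigma_finite "\<lambda>_::'a. lborel :: real measure" ..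
  have [measurable]: "f b \<in> borel_measurable borel" if "b \<in> Basis" for b
    using assms[OF that] by auto
  have coord: "(\<Prod>b\<in>Basis. f b ((\<Sum>c\<in>Basis. x c *\<^sub>R c) \<bullet> b)) = (\<Prod>b\<in>Basis. f b (x b))"
    for x :: "'a \<Rightarrow> real"
    by (intro prod.cong) auto
  have meas: "(\<lambda>x::'a. \<Prod>b\<in>Basis. f b (x \<bullet> b)) \<in> borel_measurable borel"
    by measurable
  have proj: "(\<lambda>x. \<Sum>b\<in>Basis. x b *\<^sub>R b) \<in> (\<Pi>\<^sub>M b\<in>(Basis::'a set). lborel) \<rightarrow>\<^sub>M borel"
    by measurable
  show "integrable lborel (\<lambda>x::'a. \<Prod>b\<in>Basis. f b (x \<bullet> b))"
    unfolding lborel_eq[where 'a='a]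
    by (subst integrable_distr_eq[OF proj meas], subst coord)
      (intro product_integrable_prod assms; simp)
  show "(LINT x|lborel. (\<Prod>b\<in>Basis. f b ((x::'a) \<bullet> b))) = (\<Prod>b\<in>Basis. LINT t|lborel. f b t)"
    by (subst lborel_eq[where 'a='a], subst integral_distr[OF proj meas], subst coord)
      (intro product_integral_prod assms; simp)
qed

text \<open>Up to the factor \<open>sqrt (2 * pi)\<close> this is the characteristic function of the
  standard normal distribution, which is known.\<close>

lemma
  shows integrable_iexp_gaussian_real:
      "integrable lborel (\<lambda>x::real. iexp (t * x) * complex_of_real (exp (- x\<^sup>2 / 2)))"
    and integral_iexp_gaussian_real:
      "(LINT x|lborel. iexp (t * x) * complex_of_real (exp (- x\<^sup>2 / 2)))
        = complex_of_real (sqrt (2 * pi) * exp (- t\<^sup>2 / 2))"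
proof -
  have eq: "complex_of_real (exp (- x\<^sup>2 / 2)) = complex_of_real (sqrt (2 * pi)) * complex_of_real (std_normal_density x)"
    for x :: real
  proof -
    have "exp (- x\<^sup>2 / 2) = sqrt (2 * pi) * std_normal_density x"
      by (simp add: std_normal_density_def)
    then show ?thesis by (metis of_real_mult)
  qed
  interpret real_distribution std_normal_distribution by (rule real_dist_normal_dist)
  have "integrable std_normal_distribution (\<lambda>x. iexp (t * x))"
    by (intro integrable_const_bound[where B=1]) auto
  then have int: "integrable lborel (\<lambda>x. std_normal_density x *\<^sub>R iexp (t * x))"
    by (subst (asm) integrable_density) auto
  have "integrable lborel (\<lambda>x. complex_of_real (sqrt (2 * pi)) * (std_normal_density x *\<^sub>R iexp (t * x)))"
    by (intro integrable_mult_right int)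
  also have eq': "(\<lambda>x. complex_of_real (sqrt (2 * pi)) * (std_normal_density x *\<^sub>R iexp (t * x)))
      = (\<lambda>x. iexp (t * x) * complex_of_real (exp (- x\<^sup>2 / 2)))"
    unfolding eq scaleR_conv_of_real by (simp add: mult_ac)
  finally show "integrable lborel (\<lambda>x::real. iexp (t * x) * complex_of_real (exp (- x\<^sup>2 / 2)))" .
  have "(LINT x|lborel. std_normal_density x *\<^sub>R iexp (t * x)) = char std_normal_distribution t"
    unfolding char_def by (subst integral_density) auto
  also have "\<dots> = complex_of_real (exp (- t\<^sup>2 / 2))"
    by (simp add: char_std_normal_distribution)
  finally show "(LINT x|lborel. iexp (t * x) * complex_of_real (exp (- x\<^sup>2 / 2)))
        = complex_of_real (sqrt (2 * pi) * exp (- t\<^sup>2 / 2))"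
    by (subst eq'[symmetric], subst integral_mult_right_zero, subst of_real_mult) (rule arg_cong)
qed

text \<open>The exponential and the Gaussian both factor over the coordinates, which reduces the
  integral to the one on the line.\<close>

lemma
  fixes \<xi> :: "'a::euclidean_space"
  shows integrable_iexp_gaussian:
      "integrable lborel (\<lambda>x::'a. iexp (\<xi> \<bullet> x) * complex_of_real (exp (- (norm x)\<^sup>2 / 2)))"
    and integral_iexp_gaussian:
      "(LINT x|lborel. iexp (\<xi> \<bullet> x) * complex_of_real (exp (- (norm x)\<^sup>2 / 2)))
        = complex_of_real (sqrt (2 * pi) ^ DIM('a) * exp (- (norm \<xi>)\<^sup>2 / 2))"
proof -
  have norm2: "(norm x)\<^sup>2 = (\<Sum>b\<in>Basis. (x \<bullet> b)\<^sup>2)" for x :: 'a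
    unfolding power2_norm_eq_inner by (subst euclidean_inner) (simp add: power2_eq_square)
  have split: "iexp (\<xi> \<bullet> x) * complex_of_real (exp (- (norm x)\<^sup>2 / 2))
      = (\<Prod>b\<in>Basis. iexp (\<xi> \<bullet> b * (x \<bullet> b)) * complex_of_real (exp (- (x \<bullet> b)\<^sup>2 / 2)))" for x :: 'a
  proof -
    have "complex_of_real (exp (- (norm x)\<^sup>2 / 2)) = (\<Prod>b\<in>Basis. complex_of_real (exp (- (x \<bullet> b)\<^sup>2 / 2)))"
      unfolding norm2 by (simp add: exp_sum sum_divide_distrib flip: sum_negf of_real_prod)
    moreover have "iexp (\<xi> \<bullet> x) = (\<Prod>b\<in>Basis. iexp (\<xi> \<bullet> b * (x \<bullet> b)))"
      by (subst euclidean_inner) (simp add: sum_distrib_left exp_sum)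
    ultimately show ?thesis by (simp add: prod.distrib)
  qed
  show "integrable lborel (\<lambda>x::'a. iexp (\<xi> \<bullet> x) * complex_of_real (exp (- (norm x)\<^sup>2 / 2)))"
    unfolding split
    by (rule integrable_lborel_prod[where f="\<lambda>b t. iexp (\<xi> \<bullet> b * t) * complex_of_real (exp (- t\<^sup>2 / 2))"])
      (rule integrable_iexp_gaussian_real)
  show "(LINT x|lborel. iexp (\<xi> \<bullet> x) * complex_of_real (exp (- (norm x)\<^sup>2 / 2)))
        = complex_of_real (sqrt (2 * pi) ^ DIM('a) * exp (- (norm \<xi>)\<^sup>2 / 2))"
    unfolding split norm2[of \<xi>]
    by (subst integral_lborel_prod[where f="\<lambda>b t. iexp (\<xi> \<bullet> b * t) * complex_of_real (exp (- t\<^sup>2 / 2))"])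
      (simp_all only: integrable_iexp_gaussian_real integral_iexp_gaussian_real of_real_prod[symmetric]
         prod.distrib prod_constant exp_sum[symmetric] finite_Basis sum_divide_distrib[symmetric] sum_negf)
qed

lemma
  fixes f :: "'a::euclidean_space \<Rightarrow> complex"
  assumes c: "c \<noteq> 0"
  shows integrable_lborel_affine_iff:
      "integrable lborel (\<lambda>x. f (t + c *\<^sub>R x)) \<longleftrightarrow> integrable lborel f"
    and integral_lborel_affine:
      "(LINT x|lborel. f x) = \<bar>c\<bar> ^ DIM('a) *\<^sub>R (LINT x|lborel. f (t + c *\<^sub>R x))"
proof -
  have imp: "integrable lborel (\<lambda>x. g (s + d *\<^sub>R x))" if "integrable lborel g" "d \<noteq> 0"
    for g :: "'a \<Rightarrow> complex" and s d
  proof -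
    have [measurable]: "g \<in> borel_measurable borel" using that(1) by auto
    have "integrable (density (distr lborel borel (\<lambda>x. s + d *\<^sub>R x)) (\<lambda>_. \<bar>d\<bar>^DIM('a))) g"
      using that by (subst (asm) lborel_affine[of d s]) auto
    then have "integrable lborel (\<lambda>x. complex_of_real (\<bar>d\<bar> ^ DIM('a)) * g (s + d *\<^sub>R x))"
      by (subst (asm) integrable_density) (auto simp: integrable_distr_eq scaleR_conv_of_real)
    then have "integrable lborel (\<lambda>x. complex_of_real (1 / \<bar>d\<bar> ^ DIM('a)) *
        (complex_of_real (\<bar>d\<bar> ^ DIM('a)) * g (s + d *\<^sub>R x)))"
      by (rule integrable_mult_right)
    then show ?thesis using that(2) by (simp add: field_simps)
  qed
  show iff: "integrable lborel (\<lambda>x. f (t + c *\<^sub>R x)) \<longleftrightarrow> integrable lborel f"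
  proof
    assume "integrable lborel (\<lambda>x. f (t + c *\<^sub>R x))"
    then have "integrable lborel (\<lambda>x. f (t + c *\<^sub>R (- (1/c) *\<^sub>R t + (1/c) *\<^sub>R x)))"
      using imp[of "\<lambda>x. f (t + c *\<^sub>R x)" "1/c" "- (1/c) *\<^sub>R t"] c by simp
    then show "integrable lborel f" using c by (simp add: scaleR_diff_right)
  qed (use imp c in auto)
  show "(LINT x|lborel. f x) = \<bar>c\<bar> ^ DIM('a) *\<^sub>R (LINT x|lborel. f (t + c *\<^sub>R x))"
  proof (cases "integrable lborel f")
    case True
    then have [measurable]: "f \<in> borel_measurable borel" by auto
    show ?thesis
      by (subst lborel_affine[OF c, of t], subst integral_density) (auto simp: integral_distr)
  next
    \<comment> \<open>Neither integrand is then integrable, and both integrals take the default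
      value 0.\<close>
    case False
    then show ?thesis using iff by (simp add: not_integrable_integral_eq)
  qed
qed

lemma
  fixes b :: "'a::euclidean_space"
  assumes t: "t > 0"
  shows integrable_iexp_scaled_gaussian:
      "integrable lborel (\<lambda>x::'a. iexp (b \<bullet> x) * complex_of_real (exp (- (norm (t *\<^sub>R x))\<^sup>2 / 2)))"
    and integral_iexp_scaled_gaussian:
      "(LINT x|lborel. iexp (b \<bullet> x) * complex_of_real (exp (- (norm (t *\<^sub>R x))\<^sup>2 / 2)))
        = complex_of_real ((sqrt (2 * pi) / t) ^ DIM('a) * exp (- (norm (b /\<^sub>R t))\<^sup>2 / 2))"
proof -
  let ?g = "\<lambda>x::'a. iexp ((b /\<^sub>R t) \<bullet> x) * complex_of_real (exp (- (norm x)\<^sup>2 / 2))"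
  have eq: "(\<lambda>x::'a. iexp (b \<bullet> x) * complex_of_real (exp (- (norm (t *\<^sub>R x))\<^sup>2 / 2)))
     = (\<lambda>x. ?g (0 + t *\<^sub>R x))"
  proof
    fix x :: 'a
    have "(b /\<^sub>R t) \<bullet> (0 + t *\<^sub>R x) = b \<bullet> x" using t by simp
    then show "iexp (b \<bullet> x) * complex_of_real (exp (- (norm (t *\<^sub>R x))\<^sup>2 / 2)) = ?g (0 + t *\<^sub>R x)"
      by (simp only: add_0)
  qed
  show "integrable lborel (\<lambda>x::'a. iexp (b \<bullet> x) * complex_of_real (exp (- (norm (t *\<^sub>R x))\<^sup>2 / 2)))"
    unfolding eq using t by (subst integrable_lborel_affine_iff) (simp, rule integrable_iexp_gaussian)
  have "(LINT x|lborel. ?g x) = t ^ DIM('a) *\<^sub>R (LINT x|lborel. ?g (0 + t *\<^sub>R x))"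
    using integral_lborel_affine[of t ?g 0] t by simp
  then have "(LINT x|lborel. ?g (0 + t *\<^sub>R x)) = (LINT x|lborel. ?g x) /\<^sub>R t ^ DIM('a)"
    using t by simp
  then show "(LINT x|lborel. iexp (b \<bullet> x) * complex_of_real (exp (- (norm (t *\<^sub>R x))\<^sup>2 / 2)))
        = complex_of_real ((sqrt (2 * pi) / t) ^ DIM('a) * exp (- (norm (b /\<^sub>R t))\<^sup>2 / 2))"
    unfolding eq integral_iexp_gaussian by (simp add: scaleR_conv_of_real power_divide divide_simps)
qed

text \<open>The product of \<open>a\<close> and \<open>b\<close> is integrable on the product space
  and dominates the integrand, so Fubini's theorem applies. This serves to move an exponential or
  Gaussian kernel from one function onto the other.\<close>

lemma Fubini_bounded_kernel:
  fixes a :: "'a::euclidean_space \<Rightarrow> complex" and b :: "'b::euclidean_space \<Rightarrow> complex"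
  assumes a: "integrable lborel a" and b: "integrable lborel b"
    and k[measurable]: "case_prod k \<in> borel_measurable (borel \<Otimes>\<^sub>M borel)"
    and k1: "\<And>x y. norm (k x y) \<le> 1"
  shows "(LINT x|lborel. a x * (LINT y|lborel. k x y * b y)) = (LINT y|lborel. b y * (LINT x|lborel. k x y * a x))"
proof -
  have [measurable]: "a \<in> borel_measurable borel" "b \<in> borel_measurable borel" using a b by auto
  have "integrable (lborel \<Otimes>\<^sub>M lborel) (\<lambda>(x, y). k x y * (a x * b y))"
  proof (rule Bochner_Integration.integrable_bound)
    show "integrable (lborel \<Otimes>\<^sub>M lborel) (\<lambda>(x, y). a x * b y)"
      using a b by (intro lborel_pair.Fubini_integrable) (auto simp: norm_mult)
    show "(\<lambda>(x, y). k x y * (a x * b y)) \<in> borel_measurable (lborel \<Otimes>\<^sub>M lborel)" by measurable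
    show "AE p in lborel \<Otimes>\<^sub>M lborel. norm (case p of (x, y) \<Rightarrow> k x y * (a x * b y))
        \<le> norm (case p of (x, y) \<Rightarrow> a x * b y)"
      using k1 by (intro always_eventually) (auto simp: norm_mult intro!: mult_left_le_one_le)
  qed
  from lborel_pair.Fubini_integral[OF this]
  have "(LINT y|lborel. LINT x|lborel. k x y * (a x * b y)) = (LINT x|lborel. LINT y|lborel. k x y * (a x * b y))" .
  moreover have "k x y * (a x * b y) = b y * (k x y * a x)" "k x y * (a x * b y) = a x * (k x y * b y)" for x y
    by simp_all
  ultimately show ?thesis
    by (metis (mono_tags, lifting) Bochner_Integration.integral_cong integral_mult_right_zero)
qed

text \<open>Dynkin's argument: boxes are stable under intersection and generate the Borel sets, and
  the sets over which \<open>d\<close> integrates to 0 are closed under complements, because of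
  \<open>total\<close>, and under countable disjoint unions.\<close>

lemma AE_zero_of_box_integrals:
  fixes d :: "'a::euclidean_space \<Rightarrow> complex"
  assumes d: "integrable lborel d"
    and box: "\<And>u v. (LINT x:box u v|lborel. d x) = 0" and total: "(LINT x|lborel. d x) = 0"
  shows "AE x in lborel. d x = 0"
proof (rule sigma_finite_measure.density_zero[OF lborel.sigma_finite_measure_axioms d])
  fix A :: "'a set" assume "A \<in> sets lborel"
  then have A: "A \<in> sigma_sets UNIV (range (\<lambda>(a, b). box a b))"
    by (simp add: borel_eq_box)
  have stable: "Int_stable (range (\<lambda>(a, b). box a b :: 'a set))"
    by (auto simp: Int_stable_def box_Int_box)
  have si: "set_integrable lborel B d" if "B \<in> sets borel" for B
    using d that unfolding set_integrable_def by (intro integrable_mult_indicator) auto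
  have sb: "B \<in> sets borel" if "B \<in> sigma_sets UNIV (range (\<lambda>(a, b). box a b :: 'a set))" for B
    using that by (simp add: borel_eq_box)
  have closed: "range (\<lambda>(a, b). box a b :: 'a set) \<subseteq> Pow UNIV" by simp
  from stable closed A show "(LINT x:A|lborel. d x) = 0"
  proof (induction rule: sigma_sets_induct_disjoint)
    case (compl A)
    have "(LINT x|lborel. d x) = (LINT x:A \<union> (UNIV - A)|lborel. d x)"
      by (simp add: set_lebesgue_integral_def)
    also have "\<dots> = (LINT x:A|lborel. d x) + (LINT x:UNIV - A|lborel. d x)"
      using compl sb by (intro set_integral_Un si) auto
    finally show ?case using compl total by simp
  next
    case (union A)
    have "A i \<in> sets borel" for i using union(2) sb by blast
    then have "(LINT x:(\<Union>i. A i)|lborel. d x) = (\<Sum>i. LINT x:A i|lborel. d x)"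
      using union(1) by (intro lebesgue_integral_countable_add si)
        (auto simp: disjoint_family_on_def intro!: sets.countable_UN)
    then show ?case using union by simp
  qed (use box in \<open>auto simp: set_lebesgue_integral_def\<close>)
qed

section \<open>Fourier inversion and Plancherel's identity\<close>

lemma norm_iexp_mult [simp]: "cmod (iexp r * z) = cmod z"
  by (simp add: norm_mult)

lemma fourier_measurable [measurable]:
  assumes [measurable]: "f \<in> borel_measurable borel"
  shows "fourier f \<in> borel_measurable borel"
  unfolding fourier_def[abs_def] by measurable

lemma integrable_unimodular_mult:
  fixes f :: "'a::euclidean_space \<Rightarrow> complex"
  assumes "integrable lborel f" and [measurable]: "h \<in> borel_measurable borel"
    and "\<And>x. cmod (h x) \<le> 1"
  shows "integrable lborel (\<lambda>x. h x * f x)"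
proof (rule Bochner_Integration.integrable_bound[OF assms(1)])
  show "(\<lambda>x. h x * f x) \<in> borel_measurable lborel" using assms(1) by measurable
  show "AE x in lborel. norm (h x * f x) \<le> norm (f x)"
    using assms(3) by (auto simp: norm_mult mult_left_le_one_le)
qed

text \<open>The Gaussian factor makes the double integral absolutely convergent. Exchanging the
  order leaves the transform of a Gaussian, so damping the transform of \<open>f\<close> amounts to
  mollifying \<open>f\<close> at scale \<open>t\<close>.\<close>

lemma fourier_gaussian_regularised:
  assumes f: "integrable lborel f" and t: "t > 0"
  shows "(LINT \<xi>|lborel. iexp (a \<bullet> \<xi>) * (complex_of_real (exp (- (norm (t *\<^sub>R \<xi>))\<^sup>2 / 2)) * fourier f \<xi>))
    = complex_of_real ((sqrt (2 * pi) / t) ^ 3) *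
        (LINT y|lborel. complex_of_real (exp (- (norm ((a - y) /\<^sub>R t))\<^sup>2 / 2)) * f y)"
proof -
  let ?G = "\<lambda>\<xi>::real^3. complex_of_real (exp (- (norm (t *\<^sub>R \<xi>))\<^sup>2 / 2))"
  have G: "integrable lborel ?G"
    using integrable_iexp_scaled_gaussian[OF t, of "0::real^3"] by simp
  have shift: "(LINT y|lborel. iexp ((a - y) \<bullet> \<xi>) * f y) = iexp (a \<bullet> \<xi>) * fourier f \<xi>" for \<xi>
  proof -
    have "iexp ((a - y) \<bullet> \<xi>) * f y = iexp (a \<bullet> \<xi>) * (exp (- \<i> * complex_of_real (\<xi> \<bullet> y)) * f y)" for y
      by (simp add: inner_diff_left algebra_simps inner_commute flip: exp_add)
    then show ?thesis by (simp only: fourier_def integral_mult_right_zero)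
  qed
  have "(LINT \<xi>|lborel. ?G \<xi> * (LINT y|lborel. iexp ((a - y) \<bullet> \<xi>) * f y))
    = (LINT y|lborel. f y * (LINT \<xi>|lborel. iexp ((a - y) \<bullet> \<xi>) * ?G \<xi>))"
    by (rule Fubini_bounded_kernel[OF G f]) auto
  also have "\<dots> = (LINT y|lborel. complex_of_real ((sqrt (2 * pi) / t) ^ 3) *
      (complex_of_real (exp (- (norm ((a - y) /\<^sub>R t))\<^sup>2 / 2)) * f y))"
    by (subst integral_iexp_scaled_gaussian[OF t]) (simp add: mult_ac)
  finally show ?thesis
    unfolding shift integral_mult_right_zero by (simp only: mult_ac)
qed

text \<open>The substitution \<open>a = y + t *\<^sub>R z\<close> lets \<open>t\<close> act on the
  indicator of the box alone. Its Jacobian \<open>t ^ 3\<close> cancels the normalisation, and no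
  regularity of \<open>f\<close> enters the limit of small \<open>t\<close>.\<close>

lemma box_integral_gaussian_regularised:
  assumes f: "integrable lborel f" and t: "t > 0"
  shows "(LINT a:box u v|lborel. LINT \<xi>|lborel.
        iexp (a \<bullet> \<xi>) * (complex_of_real (exp (- (norm (t *\<^sub>R \<xi>))\<^sup>2 / 2)) * fourier f \<xi>))
    = complex_of_real (sqrt (2 * pi) ^ 3) * (LINT y|lborel.
        f y * (LINT z|lborel. complex_of_real (exp (- (norm z)\<^sup>2 / 2)) * indicator (box u v) (y + t *\<^sub>R z)))"
proof -
  let ?c = "complex_of_real ((sqrt (2 * pi) / t) ^ 3)"
  let ?k = "\<lambda>a y::real^3. complex_of_real (exp (- (norm ((a - y) /\<^sub>R t))\<^sup>2 / 2))"
  let ?I = "indicator (box u v) :: real^3 \<Rightarrow> complex"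
  have I: "integrable lborel ?I"
  proof -
    have "integrable lborel (\<lambda>x. complex_of_real (indicator (box u v) x))"
      by (intro integrable_of_real integrable_real_indicator) (auto simp: emeasure_lborel_box_eq)
    also have "(\<lambda>x. complex_of_real (indicator (box u v) x)) = ?I"
      by (auto simp: indicator_def)
    finally show ?thesis .
  qed
  have scale: "(LINT a|lborel. ?k a y * ?I a)
      = complex_of_real (t ^ 3) * (LINT z|lborel. complex_of_real (exp (- (norm z)\<^sup>2 / 2)) * ?I (y + t *\<^sub>R z))" for y
    using t integral_lborel_affine[of t "\<lambda>a. ?k a y * ?I a" y]
    by (simp add: scaleR_conv_of_real[where 'a=complex])
  have "(LINT a:box u v|lborel. LINT \<xi>|lborel.
        iexp (a \<bullet> \<xi>) * (complex_of_real (exp (- (norm (t *\<^sub>R \<xi>))\<^sup>2 / 2)) * fourier f \<xi>))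
    = (LINT a|lborel. ?I a * (?c * (LINT y|lborel. ?k a y * f y)))"
    unfolding set_lebesgue_integral_def fourier_gaussian_regularised[OF assms]
    by (intro Bochner_Integration.integral_cong) (auto simp: indicator_def)
  also have "\<dots> = ?c * (LINT a|lborel. ?I a * (LINT y|lborel. ?k a y * f y))"
    by (simp only: mult.left_commute[of _ ?c] integral_mult_right_zero)
  also have "(LINT a|lborel. ?I a * (LINT y|lborel. ?k a y * f y))
    = (LINT y|lborel. f y * (LINT a|lborel. ?k a y * ?I a))"
    by (rule Fubini_bounded_kernel[OF I f]) (auto simp: norm_mult)
  also have "\<dots> = complex_of_real (t ^ 3) * (LINT y|lborel.
      f y * (LINT z|lborel. complex_of_real (exp (- (norm z)\<^sup>2 / 2)) * ?I (y + t *\<^sub>R z)))"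
    unfolding scale by (simp only: mult.left_commute[of _ "complex_of_real (t ^ 3)"] integral_mult_right_zero)
  finally show ?thesis
    using t by (simp add: power_divide)
qed

text \<open>The regularised integrals are evaluated in two ways as \<open>t n\<close> tends to 0: on
  the side of \<open>f\<close> they smooth the indicator of the box, on the side of
  \<open>fourier f\<close> the damping factor tends to 1. The two limits must agree.\<close>

lemma box_integral_fourier_inversion:
  assumes f: "integrable lborel f" and F: "integrable lborel (fourier f)"
  shows "(LINT a:box u v|lborel. LINT \<xi>|lborel. iexp (a \<bullet> \<xi>) * fourier f \<xi>)
    = complex_of_real ((2 * pi) ^ 3) * (LINT y:box u v|lborel. f y)"
proof -
  define t :: "nat \<Rightarrow> real" where "t n = 1 / Suc n" for n
  have t: "t n > 0" for n by (simp add: t_def)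
  have t0: "t \<longlonglongrightarrow> 0" unfolding t_def[abs_def] by (rule LIMSEQ_Suc[OF lim_inverse_n'])
  let ?I = "indicator (box u v) :: real^3 \<Rightarrow> complex"
  let ?g = "\<lambda>z::real^3. complex_of_real (exp (- (norm z)\<^sup>2 / 2))"
  let ?c = "complex_of_real (sqrt (2 * pi) ^ 3)"
  have [measurable]: "f \<in> borel_measurable borel" using f by auto
  have g: "integrable lborel ?g"
    using integrable_iexp_gaussian[of "0::real^3"] by simp
  have g_real: "integrable lborel (\<lambda>z::real^3. exp (- ((norm z)\<^sup>2 / 2)))"
    using integrable_norm[OF g] by simp
  have g1: "integral\<^sup>L lborel ?g = ?c"
    using integral_iexp_gaussian[of "0::real^3"] by simp
  have gI: "integrable lborel (\<lambda>z. ?g z * ?I (y + r *\<^sub>R z))" for y r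
    by (subst mult.commute, rule integrable_unimodular_mult[OF g]) (auto simp: indicator_def)
  \<comment> \<open>Off the boundary of the box its indicator is constant near
    \<open>y\<close>.\<close>
  have smooth: "(\<lambda>n. LINT z|lborel. ?g z * ?I (y + t n *\<^sub>R z)) \<longlonglongrightarrow> ?I y * ?c"
    if y: "y \<notin> cbox u v - box u v" for y
  proof -
    have "(\<lambda>n. LINT z|lborel. ?g z * ?I (y + t n *\<^sub>R z)) \<longlonglongrightarrow> (LINT z|lborel. ?g z * ?I y)"
    proof (rule integral_dominated_convergence[where w="\<lambda>z. cmod (?g z)"])
      show "AE z in lborel. (\<lambda>n. ?g z * ?I (y + t n *\<^sub>R z)) \<longlonglongrightarrow> ?g z * ?I y"
      proof (intro always_eventually allI tendsto_mult tendsto_const)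
        fix z :: "real^3"
        have lim: "(\<lambda>n. y + t n *\<^sub>R z) \<longlonglongrightarrow> y"
          using tendsto_add[OF tendsto_const tendsto_scaleR[OF t0 tendsto_const], of y z] by simp
        show "(\<lambda>n. ?I (y + t n *\<^sub>R z)) \<longlonglongrightarrow> ?I y"
        proof (cases "y \<in> box u v")
          case True
          then have "eventually (\<lambda>n. y + t n *\<^sub>R z \<in> box u v) sequentially"
            using lim open_box topological_tendstoD by blast
          then show ?thesis
            using True by (intro tendsto_eventually) (auto elim!: eventually_mono)
        next
          case False
          then have "y \<in> - cbox u v" "y \<notin> box u v" using y by auto
          then have "eventually (\<lambda>n. y + t n *\<^sub>R z \<in> - cbox u v) sequentially"
            using lim closed_cbox topological_tendstoD open_Compl by blast
          then show ?thesis
            using False box_subset_cbox[of u v] by (intro tendsto_eventually) (auto elim!: eventually_mono simp: indicator_def)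
        qed
      qed
    qed (use g g_real in \<open>auto simp: norm_mult indicator_def\<close>)
    then show ?thesis unfolding integral_mult_left_zero g1 by (simp only: mult.commute[of ?c])
  qed
  \<comment> \<open>The open and the closed box have equal volume, so the boundary is
    negligible.\<close>
  have null: "AE y in lborel. y \<notin> cbox u v - box u v"
    by (rule AE_not_in) (auto simp: null_sets_def emeasure_Diff box_subset_cbox
         emeasure_lborel_box_eq emeasure_lborel_cbox_eq)
  have "(\<lambda>n. LINT y|lborel. f y * (LINT z|lborel. ?g z * ?I (y + t n *\<^sub>R z)))
      \<longlonglongrightarrow> (LINT y|lborel. f y * (?I y * ?c))"
  proof (rule integral_dominated_convergence[where w="\<lambda>y. cmod (f y) * (LINT z|lborel. cmod (?g z))"])
    show "AE y in lborel. (\<lambda>n. f y * (LINT z|lborel. ?g z * ?I (y + t n *\<^sub>R z))) \<longlonglongrightarrow> f y * (?I y * ?c)"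
      using null by eventually_elim (intro tendsto_mult tendsto_const smooth)
    show "AE y in lborel. norm (f y * (LINT z|lborel. ?g z * ?I (y + t n *\<^sub>R z)))
        \<le> cmod (f y) * (LINT z|lborel. cmod (?g z))" for n
    proof (intro always_eventually allI)
      fix y
      have "norm (LINT z|lborel. ?g z * ?I (y + t n *\<^sub>R z)) \<le> (LINT z|lborel. cmod (?g z * ?I (y + t n *\<^sub>R z)))"
        by (rule integral_norm_bound)
      also have "\<dots> \<le> (LINT z|lborel. cmod (?g z))"
        using g gI by (intro integral_mono integrable_norm) (auto simp: indicator_def norm_mult)
      finally show "norm (f y * (LINT z|lborel. ?g z * ?I (y + t n *\<^sub>R z)))
        \<le> cmod (f y) * (LINT z|lborel. cmod (?g z))"
        unfolding norm_mult by (rule mult_left_mono) simp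
    qed
    show "integrable lborel (\<lambda>y. cmod (f y) * (LINT z|lborel. cmod (?g z)))"
      using f by (intro integrable_mult_left integrable_norm)
  qed measurable
  then have lim1: "(\<lambda>n. ?c * (LINT y|lborel. f y * (LINT z|lborel. ?g z * ?I (y + t n *\<^sub>R z))))
      \<longlonglongrightarrow> ?c * (LINT y|lborel. f y * (?I y * ?c))"
    by (intro tendsto_mult tendsto_const)
  have gauss_lim: "(\<lambda>n. LINT \<xi>|lborel. iexp (a \<bullet> \<xi>) * (?g (t n *\<^sub>R \<xi>) * fourier f \<xi>))
      \<longlonglongrightarrow> (LINT \<xi>|lborel. iexp (a \<bullet> \<xi>) * fourier f \<xi>)" for a
  proof (rule integral_dominated_convergence[where w="\<lambda>\<xi>. cmod (fourier f \<xi>)"])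
    show "AE \<xi> in lborel. (\<lambda>n. iexp (a \<bullet> \<xi>) * (?g (t n *\<^sub>R \<xi>) * fourier f \<xi>)) \<longlonglongrightarrow> iexp (a \<bullet> \<xi>) * fourier f \<xi>"
    proof (intro always_eventually allI tendsto_mult tendsto_const)
      fix \<xi> :: "real^3"
      have "(\<lambda>n. ?g (t n *\<^sub>R \<xi>) * fourier f \<xi>) \<longlonglongrightarrow> ?g (0 *\<^sub>R \<xi>) * fourier f \<xi>"
        by (intro tendsto_intros t0) auto
      then show "(\<lambda>n. ?g (t n *\<^sub>R \<xi>) * fourier f \<xi>) \<longlonglongrightarrow> fourier f \<xi>" by simp
    qed
  qed (use F in \<open>auto simp: norm_mult mult_left_le_one_le\<close>)
  have "(\<lambda>n. LINT a|lborel. indicator (box u v) a *\<^sub>R (LINT \<xi>|lborel. iexp (a \<bullet> \<xi>) * (?g (t n *\<^sub>R \<xi>) * fourier f \<xi>)))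
     \<longlonglongrightarrow> (LINT a|lborel. indicator (box u v) a *\<^sub>R (LINT \<xi>|lborel. iexp (a \<bullet> \<xi>) * fourier f \<xi>))"
  proof (rule integral_dominated_convergence[where
        w="\<lambda>a. indicator (box u v) a * (LINT \<xi>|lborel. cmod (fourier f \<xi>))"])
    show "AE a in lborel. (\<lambda>n. indicator (box u v) a *\<^sub>R (LINT \<xi>|lborel. iexp (a \<bullet> \<xi>) * (?g (t n *\<^sub>R \<xi>) * fourier f \<xi>)))
       \<longlonglongrightarrow> indicator (box u v) a *\<^sub>R (LINT \<xi>|lborel. iexp (a \<bullet> \<xi>) * fourier f \<xi>)"
      by (intro always_eventually allI tendsto_scaleR tendsto_const gauss_lim)
    show "integrable lborel (\<lambda>a. indicator (box u v) a * (LINT \<xi>|lborel. cmod (fourier f \<xi>)))"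
      by (intro integrable_mult_left integrable_real_indicator) (auto simp: emeasure_lborel_box_eq)
    show "AE a in lborel. norm (indicator (box u v) a *\<^sub>R (LINT \<xi>|lborel. iexp (a \<bullet> \<xi>) * (?g (t n *\<^sub>R \<xi>) * fourier f \<xi>)))
        \<le> indicator (box u v) a * (LINT \<xi>|lborel. cmod (fourier f \<xi>))" for n
    proof (intro always_eventually allI)
      fix a
      have gF: "integrable lborel (\<lambda>\<xi>. ?g (t n *\<^sub>R \<xi>) * fourier f \<xi>)"
        by (rule integrable_unimodular_mult[OF F]) auto
      have "norm (LINT \<xi>|lborel. iexp (a \<bullet> \<xi>) * (?g (t n *\<^sub>R \<xi>) * fourier f \<xi>))
          \<le> (LINT \<xi>|lborel. cmod (iexp (a \<bullet> \<xi>) * (?g (t n *\<^sub>R \<xi>) * fourier f \<xi>)))"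
        by (rule integral_norm_bound)
      also have "\<dots> \<le> (LINT \<xi>|lborel. cmod (fourier f \<xi>))"
        unfolding norm_iexp_mult
        by (intro integral_mono integrable_norm gF F) (auto simp: norm_mult mult_left_le_one_le)
      finally show "norm (indicator (box u v) a *\<^sub>R (LINT \<xi>|lborel. iexp (a \<bullet> \<xi>) * (?g (t n *\<^sub>R \<xi>) * fourier f \<xi>)))
        \<le> indicator (box u v) a * (LINT \<xi>|lborel. cmod (fourier f \<xi>))"
        by (auto simp: indicator_def)
    qed
  qed measurable
  then have "(\<lambda>n. ?c * (LINT y|lborel. f y * (LINT z|lborel. ?g z * ?I (y + t n *\<^sub>R z))))
      \<longlonglongrightarrow> (LINT a:box u v|lborel. LINT \<xi>|lborel. iexp (a \<bullet> \<xi>) * fourier f \<xi>)"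
    using box_integral_gaussian_regularised[OF f t, of u v] unfolding set_lebesgue_integral_def by simp
  from LIMSEQ_unique[OF this lim1]
  have "(LINT a:box u v|lborel. LINT \<xi>|lborel. iexp (a \<bullet> \<xi>) * fourier f \<xi>) = ?c * (LINT y|lborel. f y * (?I y * ?c))" .
  also have "(\<lambda>y. f y * (?I y * ?c)) = (\<lambda>y. ?c * indicator (box u v) y *\<^sub>R f y)"
    by (auto simp: indicator_def)
  also have "?c * (LINT y|lborel. ?c * indicator (box u v) y *\<^sub>R f y) = ?c * ?c * (LINT y:box u v|lborel. f y)"
    unfolding set_lebesgue_integral_def integral_mult_right_zero by simp
  \<comment> \<open>One factor is the normalisation of the Gaussian transform, the other the mass of
    the Gaussian.\<close>
  also have "?c * ?c = complex_of_real ((2 * pi) ^ 3)"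
    by (simp only: of_real_mult[symmetric] power_mult_distrib[symmetric]) simp
  finally show ?thesis .
qed

text \<open>Both sides have the same integral over every box by
  \<open>box_integral_fourier_inversion\<close>. Hence they agree almost everywhere on each box, and
  countably many boxes cover the space.\<close>

theorem fourier_inversion_AE:
  assumes f: "integrable lborel f" and F: "integrable lborel (fourier f)"
  shows "AE x in lborel. (LINT \<xi>|lborel. iexp (x \<bullet> \<xi>) * fourier f \<xi>) = complex_of_real ((2 * pi) ^ 3) * f x"
proof -
  define g where "g x = (LINT \<xi>|lborel. iexp (x \<bullet> \<xi>) * fourier f \<xi>)" for x
  let ?c = "complex_of_real ((2 * pi) ^ 3)"
  have [measurable]: "f \<in> borel_measurable borel" using f by auto
  have [measurable]: "g \<in> borel_measurable borel" unfolding g_def[abs_def] by measurable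
  have g_bound: "cmod (g x) \<le> (LINT \<xi>|lborel. cmod (fourier f \<xi>))" for x
    using integral_norm_bound[of lborel "\<lambda>\<xi>. iexp (x \<bullet> \<xi>) * fourier f \<xi>"] by (simp add: g_def)
  have "AE x in lborel. x \<in> Q \<longrightarrow> g x = ?c * f x" if Q: "Q = box p q" for p q Q
  proof -
    \<comment> \<open>The inverse transform \<open>g\<close> is only known to be bounded, so the
      difference is cut off to a box to make it integrable. Intersecting with \<open>Q\<close> turns
      boxes into boxes.\<close>
    define d where "d x = indicator Q x *\<^sub>R (g x - ?c * f x)" for x
    have sf: "set_integrable lborel (box u v) (\<lambda>x. ?c * f x)" for u v
      unfolding set_integrable_def by (intro integrable_mult_indicator integrable_mult_right f) auto
    have sg: "set_integrable lborel (box u v) g" for u v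
      unfolding set_integrable_def
    proof (rule Bochner_Integration.integrable_bound)
      show "integrable lborel (\<lambda>a. indicator (box u v) a * (LINT \<xi>|lborel. cmod (fourier f \<xi>)))"
        by (intro integrable_mult_left integrable_real_indicator) (auto simp: emeasure_lborel_box_eq)
      show "AE x in lborel. norm (indicator (box u v) x *\<^sub>R g x)
          \<le> norm (indicator (box u v) x * (LINT \<xi>|lborel. cmod (fourier f \<xi>)))"
        using g_bound by (auto simp: indicator_def intro: order_trans[OF _ abs_ge_self])
    qed measurable
    have box0: "(LINT x:box u v|lborel. g x - ?c * f x) = 0" for u v
    proof -
      have "(LINT x:box u v|lborel. g x) = ?c * (LINT x:box u v|lborel. f x)"
        unfolding g_def by (rule box_integral_fourier_inversion[OF f F])
      then show ?thesis
        by (subst set_integral_diff(2)[OF sg sf]) (simp only: set_integral_mult_right diff_self)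
    qed
    have "AE x in lborel. d x = 0"
    proof (rule AE_zero_of_box_integrals)
      show "integrable lborel d"
        using set_integral_diff(1)[OF sg sf] unfolding set_integrable_def d_def[abs_def] Q by simp
      show "(LINT x:box u v|lborel. d x) = 0" for u v
      proof -
        have "(LINT x:box u v|lborel. d x) = (LINT x:box u v \<inter> Q|lborel. g x - ?c * f x)"
          by (simp add: set_lebesgue_integral_def d_def indicator_inter_arith)
        then show ?thesis unfolding Q using box_Int_box[of u v p q] box0 by simp
      qed
      show "(LINT x|lborel. d x) = 0"
        using box0[of p q] unfolding d_def Q set_lebesgue_integral_def by simp
    qed
    then show ?thesis by eventually_elim (auto simp: d_def)
  qed
  then have "AE x in lborel. \<forall>i::nat. x \<in> box (- (real i *\<^sub>R One)) (real i *\<^sub>R One) \<longrightarrow> g x = ?c * f x"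
    by (subst AE_all_countable) auto
  then have "AE x in lborel. g x = ?c * f x"
    by eventually_elim (use UN_box_eq_UNIV in auto)
  then show ?thesis unfolding g_def .
qed

text \<open>Inversion replaces the second factor of \<open>cnj (f x) * f x\<close>, and Fubini turns
  the remaining integral over \<open>x\<close> into the conjugate of the transform.\<close>

theorem plancherel:
  assumes f: "integrable lborel f" and F: "integrable lborel (fourier f)"
  shows "L2_norm_sq f = (LINT \<xi>|lborel. (cmod (fourier f \<xi>))\<^sup>2) / (2 * pi) ^ 3"
proof -
  let ?c = "complex_of_real ((2 * pi) ^ 3)"
  have [measurable]: "f \<in> borel_measurable borel" using f by auto
  have [measurable]: "(\<lambda>x. cnj (f x)) \<in> borel_measurable borel"
    using borel_measurable_integrable[of lborel "\<lambda>x. cnj (f x)"] f by simp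
  have "?c * complex_of_real (L2_norm_sq f) = (LINT x|lborel. cnj (f x) * (?c * f x))"
  proof -
    have "cnj (f x) * (?c * f x) = ?c * complex_of_real ((cmod (f x))\<^sup>2)" for x
      using complex_norm_square[of "f x"] by (simp only: of_real_power mult_ac)
    then show ?thesis
      unfolding L2_norm_sq_def by (simp only: integral_mult_right_zero integral_complex_of_real)
  qed
  also have "\<dots> = (LINT x|lborel. cnj (f x) * (LINT \<xi>|lborel. iexp (x \<bullet> \<xi>) * fourier f \<xi>))"
    using fourier_inversion_AE[OF f F]
    by (intro integral_cong_AE) (measurable, auto)
  also have "\<dots> = (LINT \<xi>|lborel. fourier f \<xi> * (LINT x|lborel. iexp (x \<bullet> \<xi>) * cnj (f x)))"
    using f F by (intro Fubini_bounded_kernel) auto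
  also have "\<dots> = (LINT \<xi>|lborel. fourier f \<xi> * cnj (fourier f \<xi>))"
  proof -
    have "iexp (x \<bullet> \<xi>) * cnj (f x) = cnj (exp (- \<i> * complex_of_real (\<xi> \<bullet> x)) * f x)" for x \<xi>
      by (simp add: exp_cnj inner_commute)
    then have "(LINT x|lborel. iexp (x \<bullet> \<xi>) * cnj (f x)) = cnj (fourier f \<xi>)" for \<xi>
      by (simp only: fourier_def Bochner_Integration.integral_cnj)
    then show ?thesis by simp
  qed
  also have "\<dots> = complex_of_real (LINT \<xi>|lborel. (cmod (fourier f \<xi>))\<^sup>2)"
    unfolding complex_norm_square[symmetric] by (simp only: integral_complex_of_real flip: of_real_power)
  finally have "(2 * pi) ^ 3 * L2_norm_sq f = (LINT \<xi>|lborel. (cmod (fourier f \<xi>))\<^sup>2)"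
    by (simp only: of_real_mult[symmetric] of_real_eq_iff)
  then show ?thesis by (simp add: field_simps)
qed

section \<open>Extrapolation of the Fourier transform\<close>

text \<open>Rankin's trick: from index \<open>N\<close> on, the weight \<open>exp (j - N)\<close> is
  at least 1, and inserting it produces the exponential series at \<open>exp 1 * x\<close>.\<close>

lemma exp_tail_le:
  fixes x :: real
  assumes "x \<ge> 0"
  shows "(\<Sum>j=N..m. x ^ j / fact j) \<le> exp (exp 1 * x - real N)"
proof -
  have "(\<Sum>j=N..m. x ^ j / fact j) \<le> (\<Sum>j=N..m. exp (- real N) * ((exp 1 * x) ^ j / fact j))"
  proof (rule sum_mono)
    fix j assume "j \<in> {N..m}"
    then have "1 \<le> exp (real j - real N)" by simp
    also have "\<dots> = exp (- real N) * exp 1 ^ j"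
      by (simp add: exp_diff exp_minus divide_simps flip: exp_of_nat_mult)
    finally have "1 * (x ^ j / fact j) \<le> (exp (- real N) * exp 1 ^ j) * (x ^ j / fact j)"
      using assms by (intro mult_right_mono) auto
    then show "x ^ j / fact j \<le> exp (- real N) * ((exp 1 * x) ^ j / fact j)"
      by (simp add: power_mult_distrib)
  qed
  also have "\<dots> = exp (- real N) * (\<Sum>j=N..m. (exp 1 * x) ^ j /\<^sub>R fact j)"
    by (simp add: sum_distrib_left divide_inverse mult_ac)
  also have "\<dots> \<le> exp (- real N) * exp (exp 1 * x)"
    by (subst sums_unique[OF exp_converges], intro mult_left_mono sum_le_suminf summable_exp_generic)
      (use assms in auto)
  finally show ?thesis by (simp add: exp_diff exp_minus divide_simps)
qed

text \<open>Newton's forward difference formula: with \<open>z = exp (- \<i> q \<bullet> y / m)\<close> the value at \<open>\<xi> = p + q\<close>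
  has the integrand \<open>z ^ m = (1 + (z - 1)) ^ m\<close>. The terms of order \<open>j < N\<close> of its binomial expansion only
  involve values of the transform close to \<open>p\<close>, while \<open>z - 1\<close> is small on the support of \<open>f\<close>.\<close>

lemma fourier_extrapolation:
  assumes f: "integrable lborel f" and supp: "{x. f x \<noteq> 0} \<subseteq> ball 0 R"
    and small: "\<And>\<eta>. \<eta> \<in> ball p r \<Longrightarrow> cmod (fourier f \<eta>) \<le> \<epsilon>" and \<epsilon>: "\<epsilon> \<ge> 0"
    and T: "norm (\<xi> - p) \<le> T" "T > 0" and m: "real N * T \<le> real m * r" "N \<le> m" "m > 0" and R: "R \<ge> 0"
  shows "cmod (fourier f \<xi>) \<le> \<epsilon> * (real N * (2 * real m) ^ N)
    + exp (exp 1 * (R * T) - real N) * (LINT y|lborel. cmod (f y))"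
proof -
  define q where "q = \<xi> - p"
  define e where "e y = exp (- \<i> * complex_of_real (p \<bullet> y))" for y :: "real^3"
  define z where "z y = exp (- \<i> * complex_of_real (q \<bullet> y / m))" for y :: "real^3"
  define rest where "rest y = (\<Sum>j=N..m. of_nat (m choose j) * (z y - 1) ^ j)" for y
  have [measurable]: "f \<in> borel_measurable borel" using f by auto
  have [measurable]: "e \<in> borel_measurable borel" "z \<in> borel_measurable borel"
    unfolding e_def[abs_def] z_def[abs_def] by measurable
  have e1: "cmod (e y) = 1" and z1: "cmod (z y) = 1" for y
    by (simp_all add: e_def z_def)
  have ez: "integrable lborel (\<lambda>y. e y * z y ^ i * f y)" for i
    by (rule integrable_unimodular_mult[OF f]) (auto simp: norm_mult norm_power e1 z1)
  \<comment> \<open>The nodes are equally spaced on the line through \<open>p\<close> and \<xi>,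
    with \<xi> itself at \<open>i = m\<close>.\<close>
  have node: "fourier f (p + (real i / real m) *\<^sub>R q) = (LINT y|lborel. e y * z y ^ i * f y)" for i
  proof -
    have "exp (- \<i> * complex_of_real ((p + (real i / real m) *\<^sub>R q) \<bullet> y)) = e y * z y ^ i" for y
      unfolding e_def z_def exp_of_nat_mult[symmetric] exp_add[symmetric]
      by (simp add: inner_add_left algebra_simps)
    then show ?thesis by (simp add: fourier_def)
  qed
  \<comment> \<open>The first \<open>N\<close> nodes lie in the ball around \<open>p\<close> because
    \<open>N * T <= m * r\<close>.\<close>
  have node_small: "cmod (LINT y|lborel. e y * z y ^ i * f y) \<le> \<epsilon>" if "i < N" for i
  proof -
    have "real i * norm q \<le> real i * T" using T(1) unfolding q_def by (intro mult_left_mono) auto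
    also have "\<dots> < real N * T" using that T(2) by simp
    finally have "real i * norm q < real m * r" using m(1) by simp
    then have "real i / real m * norm q < r" using m(3) by (simp add: field_simps)
    then have "p + (real i / real m) *\<^sub>R q \<in> ball p r" by (simp add: dist_norm)
    from small[OF this] show ?thesis unfolding node .
  qed
  have diff_eq: "e y * (z y - 1) ^ j * f y
      = (\<Sum>i\<le>j. of_nat (j choose i) * (-1) ^ (j - i) * (e y * z y ^ i * f y))" for j y
    using binomial_ring[of "z y" "-1" j] by (simp add: sum_distrib_left sum_distrib_right mult_ac)
  have diff_int: "integrable lborel (\<lambda>y. e y * (z y - 1) ^ j * f y)" for j
    unfolding diff_eq by (intro Bochner_Integration.integrable_sum integrable_mult_right ez)
  \<comment> \<open>The factor \<open>2 ^ j\<close> is the sum of the binomial coefficients in the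
    \<open>j\<close>-th difference.\<close>
  have diff_small: "cmod (LINT y|lborel. e y * (z y - 1) ^ j * f y) \<le> 2 ^ j * \<epsilon>" if "j < N" for j
  proof -
    have "(LINT y|lborel. e y * (z y - 1) ^ j * f y)
        = (\<Sum>i\<le>j. of_nat (j choose i) * (-1) ^ (j - i) * (LINT y|lborel. e y * z y ^ i * f y))"
      unfolding diff_eq by (subst Bochner_Integration.integral_sum) (auto intro!: integrable_mult_right ez)
    also have "cmod \<dots> \<le> (\<Sum>i\<le>j. real (j choose i) * \<epsilon>)"
      using that node_small by (intro sum_norm_le) (auto simp: norm_mult norm_power intro!: mult_left_mono)
    also have "\<dots> = 2 ^ j * \<epsilon>"
      by (simp add: choose_row_sum flip: sum_distrib_right of_nat_sum)
    finally show ?thesis .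
  qed
  have "z y ^ m = (\<Sum>j<N. of_nat (m choose j) * (z y - 1) ^ j) + rest y" for y
  proof -
    have "z y ^ m = (\<Sum>j\<le>m. of_nat (m choose j) * (z y - 1) ^ j)"
      using binomial_ring[of "z y - 1" 1 m] by simp
    also have "{..m} = {..<N} \<union> {N..m}" using m(2) by auto
    finally show ?thesis unfolding rest_def by (subst (asm) sum.union_disjoint) auto
  qed
  then have expand: "e y * z y ^ m * f y
      = (\<Sum>j<N. of_nat (m choose j) * (e y * (z y - 1) ^ j * f y)) + e y * rest y * f y" for y
    by (simp add: algebra_simps sum_distrib_left sum_distrib_right)
  have rest_eq: "e y * rest y * f y = (\<Sum>j=N..m. of_nat (m choose j) * (e y * (z y - 1) ^ j * f y))" for y
    by (simp add: rest_def sum_distrib_left sum_distrib_right mult_ac)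
  have rest_int: "integrable lborel (\<lambda>y. e y * rest y * f y)"
    unfolding rest_eq by (intro Bochner_Integration.integrable_sum integrable_mult_right diff_int)
  have rest_le: "cmod (e y * rest y * f y) \<le> exp (exp 1 * (R * T) - real N) * cmod (f y)" for y
  proof (cases "f y = 0")
    case False
    then have y: "norm y \<le> R" using supp by (auto simp: subset_iff less_imp_le)
    have "cmod (z y - 1) \<le> \<bar>- (q \<bullet> y / m)\<bar>"
      using iexp_approx1[of "- (q \<bullet> y / m)" 0] unfolding z_def by simp
    also have "\<dots> \<le> R * T / m"
    proof -
      have "\<bar>q \<bullet> y\<bar> \<le> norm q * norm y" by (rule Cauchy_Schwarz_ineq2)
      also have "\<dots> \<le> T * R" using T y unfolding q_def by (intro mult_mono) auto
      finally show ?thesis by (simp add: divide_right_mono mult.commute)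
    qed
    finally have zle: "cmod (z y - 1) \<le> R * T / m" .
    \<comment> \<open>The bound \<open>m choose j <= m ^ j / fact j\<close> cancels the powers of
      \<open>m\<close> in \<open>(R * T / m) ^ j\<close>, so the remainder is controlled by the tail
      of the exponential series at \<open>R * T\<close>, whatever the step number
      \<open>m\<close>.\<close>
    have "cmod (rest y) \<le> (\<Sum>j=N..m. (R * T) ^ j / fact j)"
      unfolding rest_def
    proof (rule sum_norm_le)
      fix j
      have "real (m choose j) \<le> real m ^ j / fact j"
      proof -
        have "real ((m choose j) * fact j) \<le> real (m ^ j)"
          using binomial_fact_pow by (rule of_nat_mono)
        then show ?thesis by (simp add: field_simps)
      qed
      moreover have "cmod (z y - 1) ^ j \<le> (R * T / m) ^ j" using zle by (intro power_mono) auto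
      ultimately have "real (m choose j) * cmod (z y - 1) ^ j \<le> (real m ^ j / fact j) * (R * T / m) ^ j"
        by (intro mult_mono) auto
      also have "\<dots> = (R * T) ^ j / fact j" using m(3) by (simp add: power_divide power_mult_distrib)
      finally show "cmod (of_nat (m choose j) * (z y - 1) ^ j) \<le> (R * T) ^ j / fact j"
        by (simp add: norm_mult norm_power)
    qed
    also have "\<dots> \<le> exp (exp 1 * (R * T) - real N)"
      using T R by (intro exp_tail_le) auto
    finally show ?thesis by (simp add: norm_mult e1 mult_right_mono)
  qed simp
  have "fourier f \<xi> = (LINT y|lborel. e y * z y ^ m * f y)"
    using node[of m] m(3) by (simp add: q_def)
  also have "\<dots> = (\<Sum>j<N. of_nat (m choose j) * (LINT y|lborel. e y * (z y - 1) ^ j * f y))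
      + (LINT y|lborel. e y * rest y * f y)"
    unfolding expand using diff_int rest_int
    by (subst Bochner_Integration.integral_add)
      (auto simp: Bochner_Integration.integral_sum intro!: Bochner_Integration.integrable_sum integrable_mult_right)
  also have "cmod \<dots> \<le> (\<Sum>j<N. \<epsilon> * (2 * real m) ^ N) + exp (exp 1 * (R * T) - real N) * (LINT y|lborel. cmod (f y))"
  proof (intro order_trans[OF norm_triangle_ineq] add_mono sum_norm_le)
    fix j assume "j \<in> {..<N}"
    then have j: "j < N" by simp
    have "cmod (of_nat (m choose j) * (LINT y|lborel. e y * (z y - 1) ^ j * f y)) \<le> real m ^ j * (2 ^ j * \<epsilon>)"
      unfolding norm_mult using diff_small[OF j]
    proof (intro mult_mono)
      have "m choose j \<le> m ^ j"
        using binomial_fact_pow[of m j] fact_ge_1[of j, where ?'a=nat]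
        by (metis dual_order.trans mult.commute mult_le_mono1 nat_mult_1)
      then show "cmod (of_nat (m choose j)) \<le> real m ^ j" by (simp flip: of_nat_power)
    qed auto
    also have "\<dots> = \<epsilon> * (2 * real m) ^ j" by (simp add: power_mult_distrib)
    also have "\<dots> \<le> \<epsilon> * (2 * real m) ^ N" using j m(3) \<epsilon> by (intro mult_left_mono power_increasing) auto
    finally show "cmod (of_nat (m choose j) * (LINT y|lborel. e y * (z y - 1) ^ j * f y)) \<le> \<epsilon> * (2 * real m) ^ N" .
  next
    have "cmod (LINT y|lborel. e y * rest y * f y) \<le> (LINT y|lborel. cmod (e y * rest y * f y))"
      by (rule integral_norm_bound)
    also have "\<dots> \<le> (LINT y|lborel. exp (exp 1 * (R * T) - real N) * cmod (f y))"
      using rest_le f by (intro integral_mono integrable_norm rest_int integrable_mult_right)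
    finally show "cmod (LINT y|lborel. e y * rest y * f y)
        \<le> exp (exp 1 * (R * T) - real N) * (LINT y|lborel. cmod (f y))" by simp
  qed
  finally show ?thesis by (simp add: mult_ac)
qed

section \<open>From far-field data to the Fourier transform on a ball\<close>

lemma far_field_eq_fourier: "far_field f x k = fourier f (k *\<^sub>R x)"
  by (simp add: far_field_def fourier_def)

lemma norm_fourier_le: "cmod (fourier f \<xi>) \<le> (LINT y|lborel. cmod (f y))"
proof -
  have "cmod (exp (- \<i> * complex_of_real (\<xi> \<bullet> y)) * f y) = cmod (f y)" for y
    by (simp add: norm_mult)
  then show ?thesis
    using integral_norm_bound[of lborel "\<lambda>y. exp (- \<i> * complex_of_real (\<xi> \<bullet> y)) * f y"]
    unfolding fourier_def by simp
qed

text \<open>A point at distance \<open>d < 1/4\<close> from \<open>x0 /\<^sub>R 2\<close> has norm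
  between 1/4 and 3/4. Its direction then differs from \<open>x0\<close> by at most
  \<open>2 * d / (1/4) = 8 * d\<close>, which explains the radius \<open>\<delta>/8\<close>.\<close>

lemma ball_subset_cone:
  assumes x0: "x0 \<in> sphere 0 1" and \<eta>: "\<eta> \<in> ball (x0 /\<^sub>R 2) (min (1/4) (\<delta>/8))"
  obtains x k where "\<eta> = k *\<^sub>R x" "x \<in> sph_nbhd x0 \<delta>" "0 < k" "k < 1"
proof
  define d where "d = norm (\<eta> - x0 /\<^sub>R 2)"
  have d: "d < 1/4" "d < \<delta>/8" using \<eta> by (auto simp: d_def dist_norm norm_minus_commute)
  have half: "norm (x0 /\<^sub>R 2) = 1/2" using x0 by simp
  have k: "\<bar>norm \<eta> - 1/2\<bar> \<le> d"
    using norm_triangle_ineq3[of \<eta> "x0 /\<^sub>R 2"] half unfolding d_def by simp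
  then have kpos: "norm \<eta> > 1/4" using d by linarith
  show "\<eta> = norm \<eta> *\<^sub>R (\<eta> /\<^sub>R norm \<eta>)" "0 < norm \<eta>" "norm \<eta> < 1"
  proof -
    show "\<eta> = norm \<eta> *\<^sub>R (\<eta> /\<^sub>R norm \<eta>)" "0 < norm \<eta>"
      using kpos by (cases "\<eta> = 0"; simp)+
    show "norm \<eta> < 1" using k d by linarith
  qed
  have "norm (\<eta> - norm \<eta> *\<^sub>R x0) = norm ((\<eta> - x0 /\<^sub>R 2) + (1/2 - norm \<eta>) *\<^sub>R x0)"
    by (simp add: algebra_simps)
  also have "\<dots> \<le> d + \<bar>1/2 - norm \<eta>\<bar> * norm x0"
    unfolding d_def by (rule order_trans[OF norm_triangle_ineq]) simp
  also have "\<dots> \<le> 2 * d" using k x0 by (simp add: abs_minus_commute)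
  finally have num: "norm (\<eta> - norm \<eta> *\<^sub>R x0) \<le> 2 * d" .
  have "\<eta> /\<^sub>R norm \<eta> - x0 = (\<eta> - norm \<eta> *\<^sub>R x0) /\<^sub>R norm \<eta>"
    using kpos by (cases "\<eta> = 0") (auto simp: scaleR_diff_right)
  then have "norm (\<eta> /\<^sub>R norm \<eta> - x0) = norm (\<eta> - norm \<eta> *\<^sub>R x0) / norm \<eta>"
    by (simp add: divide_inverse mult.commute)
  also have "\<dots> \<le> 2 * d / (1/4)"
    using num kpos by (intro frac_le) (auto simp: d_def)
  also have "\<dots> < \<delta>" using d by simp
  finally show "\<eta> /\<^sub>R norm \<eta> \<in> sph_nbhd x0 \<delta>"
    using kpos by (cases "\<eta> = 0") (auto simp: sph_nbhd_def)
qed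

text \<open>The frequencies met in the ball are below 1 and hence below \<open>K\<close>. The far
  field is bounded by the integral of \<open>cmod (f y)\<close>, so the supremum is a genuine upper
  bound.\<close>

lemma fourier_le_ff_sup:
  assumes x0: "x0 \<in> sphere 0 1" and \<eta>: "\<eta> \<in> ball (x0 /\<^sub>R 2) (min (1/4) (\<delta>/8))" and K: "K > 1"
  shows "cmod (fourier f \<eta>) \<le> ff_sup f x0 \<delta> K"
proof -
  obtain x k where xk: "\<eta> = k *\<^sub>R x" "x \<in> sph_nbhd x0 \<delta>" "0 < k" "k < 1"
    using ball_subset_cone[OF x0 \<eta>] .
  have "bdd_above ((\<lambda>p. cmod (far_field f (fst p) (snd p))) ` (sph_nbhd x0 \<delta> \<times> {0<..<K}))"
    using norm_fourier_le by (intro bdd_aboveI2) (auto simp: far_field_eq_fourier)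
  moreover have "(x, k) \<in> sph_nbhd x0 \<delta> \<times> {0<..<K}" using xk K by auto
  ultimately show ?thesis
    unfolding ff_sup_def using cSUP_upper[of "(x, k)" _ "\<lambda>p. cmod (far_field f (fst p) (snd p))"] xk(1)
    by (fastforce simp: far_field_eq_fourier)
qed

text \<open>Each \<open>1 + (x \<bullet> b)\<^sup>2\<close> is at most
  \<open>1 + (norm x)\<^sup>2\<close>, so the weight is dominated by a product of one-dimensional
  Cauchy densities, up to a constant.\<close>

lemma integrable_inverse_weight:
  "integrable lborel (\<lambda>x::'a::euclidean_space. 1 / (1 + (norm x)\<^sup>2) ^ DIM('a))"
proof (rule Bochner_Integration.integrable_bound)
  have "integrable lborel (\<lambda>t::real. complex_of_real (inverse (1 + t\<^sup>2)))"
    using integrable_inverse_1_plus_square unfolding set_integrable_def by (intro integrable_of_real) simp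
  then show "integrable lborel (\<lambda>x::'a. \<Prod>b\<in>Basis. complex_of_real (inverse (1 + (x \<bullet> b)\<^sup>2)))"
    by (intro integrable_lborel_prod[where f="\<lambda>b t. complex_of_real (inverse (1 + t\<^sup>2))"])
  show "AE x in lborel. norm (1 / (1 + (norm x)\<^sup>2) ^ DIM('a))
      \<le> norm (\<Prod>b\<in>Basis. complex_of_real (inverse (1 + ((x::'a) \<bullet> b)\<^sup>2)))"
  proof (intro always_eventually allI)
    fix x :: 'a
    have "(\<Prod>b\<in>Basis. 1 + (x \<bullet> b)\<^sup>2) \<le> (\<Prod>b\<in>(Basis::'a set). 1 + (norm x)\<^sup>2)"
      using Basis_le_norm by (intro prod_mono) (auto simp: abs_le_square_iff[symmetric])
    moreover have "(\<Prod>b\<in>Basis. 1 + (x \<bullet> b)\<^sup>2) > 0" by (intro prod_pos) (auto intro: add_pos_nonneg)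
    ultimately have "1 / (1 + (norm x)\<^sup>2) ^ DIM('a) \<le> 1 / (\<Prod>b\<in>Basis. 1 + (x \<bullet> b)\<^sup>2)"
      by (intro frac_le) auto
    also have "\<dots> = (\<Prod>b\<in>Basis. norm (complex_of_real (inverse (1 + (x \<bullet> b)\<^sup>2))))"
      unfolding norm_of_real by (simp add: divide_inverse prod_inversef[symmetric] abs_of_nonneg)
    finally show "norm (1 / (1 + (norm x)\<^sup>2) ^ DIM('a)) \<le> norm (\<Prod>b\<in>Basis. complex_of_real (inverse (1 + (x \<bullet> b)\<^sup>2)))"
      by (simp add: prod_norm)
  qed
qed measurable

section \<open>The admissible class\<close>

text \<open>On the ball the elementary inequality \<open>2 * t <= 1 + t\<^sup>2\<close> bounds
  \<open>cmod (f x)\<close>; elsewhere \<open>f\<close> vanishes.\<close>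

lemma
  assumes f: "L2_fun f" and supp: "{x. f x \<noteq> 0} \<subseteq> ball 0 R" and R: "R \<ge> 0"
  shows integrable_L2_fun_bounded_support: "integrable lborel f"
    and L1_norm_le: "(LINT y|lborel. cmod (f y)) \<le> unit_ball_vol 3 * R ^ 3 + L2_norm_sq f"
proof -
  have [measurable]: "f \<in> borel_measurable borel" and f2: "integrable lborel (\<lambda>x. (cmod (f x))\<^sup>2)"
    using f by (auto simp: L2_fun_def)
  have ball: "integrable lborel (indicator (cball 0 R) :: real^3 \<Rightarrow> real)"
    using R by (intro integrable_real_indicator) (auto simp: emeasure_cball)
  have le: "cmod (f x) \<le> indicator (cball 0 R) x + (cmod (f x))\<^sup>2" for x
  proof (cases "f x = 0")
    case False
    then have "x \<in> cball 0 R" using supp by (auto simp: subset_iff less_imp_le)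
    moreover have "2 * cmod (f x) \<le> 1 + (cmod (f x))\<^sup>2"
      using zero_le_power2[of "cmod (f x) - 1"] by (simp add: power2_diff)
    ultimately show ?thesis using norm_ge_zero[of "f x"] by (simp del: norm_ge_zero)
  qed simp
  show int: "integrable lborel f"
    by (rule Bochner_Integration.integrable_bound[OF Bochner_Integration.integrable_add[OF ball f2]])
      (auto intro!: always_eventually le)
  have "(LINT y|lborel. cmod (f y)) \<le> (LINT x|lborel. indicator (cball 0 R) x + (cmod (f x))\<^sup>2)"
    using int ball f2 le by (intro integral_mono integrable_norm Bochner_Integration.integrable_add)
  also have "\<dots> = measure lborel (cball 0 R :: (real^3) set) + L2_norm_sq f"
    using ball f2 by (simp add: L2_norm_sq_def)
  also have "measure lborel (cball 0 R :: (real^3) set) = unit_ball_vol 3 * R ^ 3"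
    using R by (simp add: measure_def emeasure_cball)
  finally show "(LINT y|lborel. cmod (f y)) \<le> unit_ball_vol 3 * R ^ 3 + L2_norm_sq f" .
qed

text \<open>This supplies the hypothesis on \<open>fourier f\<close> in \<open>plancherel\<close>.
  By AM-GM, \<open>c <= 1 / w + w * c\<^sup>2\<close>; for
  \<open>w = (1 + (norm \<xi>)\<^sup>2) ^ 3\<close> the first term is integrable in dimension 3, and
  the second is below the Sobolev density once \<open>m >= 3\<close>.\<close>

lemma integrable_fourier_in_H:
  assumes f: "in_H m f" and m: "m \<ge> 3"
  shows "integrable lborel (fourier f)"
proof (rule Bochner_Integration.integrable_bound)
  have [measurable]: "f \<in> borel_measurable borel" using f by (auto simp: in_H_def L2_fun_def)
  show "integrable lborel (\<lambda>\<xi>. 1 / (1 + (norm \<xi>)\<^sup>2) ^ 3 + (1 + (norm \<xi>)\<^sup>2) ^ m * (cmod (fourier f \<xi>))\<^sup>2)"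
    using f integrable_inverse_weight[where 'a="real^3"]
    by (intro Bochner_Integration.integrable_add) (auto simp: in_H_def)
  show "fourier f \<in> borel_measurable lborel" by simp
  show "AE \<xi> in lborel. norm (fourier f \<xi>)
      \<le> norm (1 / (1 + (norm \<xi>)\<^sup>2) ^ 3 + (1 + (norm \<xi>)\<^sup>2) ^ m * (cmod (fourier f \<xi>))\<^sup>2)"
  proof (intro always_eventually allI)
    fix \<xi> :: "real^3"
    define w where "w = (1 + (norm \<xi>)\<^sup>2) ^ 3"
    define c where "c = cmod (fourier f \<xi>)"
    have w: "w \<ge> 1" unfolding w_def by (intro one_le_power) auto
    have wm: "w \<le> (1 + (norm \<xi>)\<^sup>2) ^ m" unfolding w_def using m by (intro power_increasing) auto
    have "0 \<le> (w * c - 1)\<^sup>2" by simp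
    then have "2 * (w * c) \<le> 1 + w * w * c\<^sup>2" by (simp add: power2_eq_square algebra_simps)
    then have "2 * c \<le> 1 / w + w * c\<^sup>2" using w by (simp add: field_simps)
    moreover have "0 \<le> c" by (simp add: c_def)
    ultimately have "c \<le> 1 / w + w * c\<^sup>2" by linarith
    also have "\<dots> \<le> 1 / w + (1 + (norm \<xi>)\<^sup>2) ^ m * c\<^sup>2" using wm by (intro add_mono mult_right_mono) auto
    finally show "norm (fourier f \<xi>)
      \<le> norm (1 / (1 + (norm \<xi>)\<^sup>2) ^ 3 + (1 + (norm \<xi>)\<^sup>2) ^ m * (cmod (fourier f \<xi>))\<^sup>2)"
      unfolding c_def w_def real_norm_def by (rule order_trans[OF _ abs_ge_self])
  qed
qed

lemma adm_class_weighted_integral_le: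
  assumes "f \<in> adm_class R M m"
  shows "(LINT \<xi>|lborel. (1 + (norm \<xi>)\<^sup>2) ^ m * (cmod (fourier f \<xi>))\<^sup>2) \<le> (2 * pi) ^ 3 * M\<^sup>2"
proof -
  define I where "I = (LINT \<xi>|lborel. (1 + (norm \<xi>)\<^sup>2) ^ m * (cmod (fourier f \<xi>))\<^sup>2)"
  have I: "I \<ge> 0" unfolding I_def by (intro Bochner_Integration.integral_nonneg) auto
  have "sqrt (1 / (2 * pi) ^ 3 * I) \<le> M" using assms by (simp add: adm_class_def H_norm_def I_def)
  then have "(sqrt (1 / (2 * pi) ^ 3 * I))\<^sup>2 \<le> M\<^sup>2" using I by (intro power_mono) auto
  then have "1 / (2 * pi) ^ 3 * I \<le> M\<^sup>2" using I by simp
  then show ?thesis unfolding I_def by (simp add: field_simps)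
qed

lemma adm_class_integrable:
  assumes f: "f \<in> adm_class R M m" and R: "R \<ge> 0" and m: "m \<ge> 3"
  shows "integrable lborel f" "integrable lborel (fourier f)"
    "integrable lborel (\<lambda>\<xi>. (1 + (norm \<xi>)\<^sup>2) ^ m * (cmod (fourier f \<xi>))\<^sup>2)"
    "integrable lborel (\<lambda>\<xi>. (cmod (fourier f \<xi>))\<^sup>2)"
proof -
  have H: "in_H m f" and supp: "{x. f x \<noteq> 0} \<subseteq> ball 0 R" using f by (auto simp: adm_class_def)
  show int: "integrable lborel f"
    using H supp R integrable_L2_fun_bounded_support by (auto simp: in_H_def)
  show "integrable lborel (fourier f)" using integrable_fourier_in_H[OF H m] .
  show W: "integrable lborel (\<lambda>\<xi>. (1 + (norm \<xi>)\<^sup>2) ^ m * (cmod (fourier f \<xi>))\<^sup>2)"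
    using H by (simp add: in_H_def)
  have [measurable]: "f \<in> borel_measurable borel" using int by auto
  show "integrable lborel (\<lambda>\<xi>. (cmod (fourier f \<xi>))\<^sup>2)"
    by (rule Bochner_Integration.integrable_bound[OF W])
      (auto simp: abs_mult intro!: always_eventually mult_le_cancel_right1[THEN iffD2] one_le_power)
qed

lemma adm_class_L2_norm_sq_le:
  assumes f: "f \<in> adm_class R M m" and R: "R \<ge> 0" and m: "m \<ge> 3"
  shows "L2_norm_sq f \<le> M\<^sup>2"
proof -
  note int = adm_class_integrable[OF assms]
  have "(LINT \<xi>|lborel. (cmod (fourier f \<xi>))\<^sup>2)
      \<le> (LINT \<xi>|lborel. (1 + (norm \<xi>)\<^sup>2) ^ m * (cmod (fourier f \<xi>))\<^sup>2)"
    using int by (intro integral_mono) (auto intro!: mult_le_cancel_right1[THEN iffD2] one_le_power)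
  also have "\<dots> \<le> (2 * pi) ^ 3 * M\<^sup>2" by (rule adm_class_weighted_integral_le[OF f])
  finally show ?thesis unfolding plancherel[OF int(1,2)] by (simp add: field_simps)
qed

text \<open>After Plancherel, frequencies up to \<open>s\<close> contribute at most
  \<open>B\<^sup>2\<close> times the volume of a ball, while beyond \<open>s\<close> the Sobolev
  weight is at least \<open>s ^ (2 * m)\<close>.\<close>

lemma L2_norm_sq_split:
  assumes f: "f \<in> adm_class R M m" and R: "R \<ge> 0" and m: "m \<ge> 3" and s: "s > 0"
    and B: "\<And>\<xi>. norm \<xi> \<le> s \<Longrightarrow> cmod (fourier f \<xi>) \<le> B"
  shows "L2_norm_sq f \<le> unit_ball_vol 3 * s ^ 3 * B\<^sup>2 + M\<^sup>2 / s ^ (2 * m)"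
proof -
  note int = adm_class_integrable[OF f R m]
  have ball: "integrable lborel (\<lambda>\<xi>::real^3. B\<^sup>2 * indicator (cball 0 s) \<xi> )"
    using s by (intro integrable_mult_right integrable_real_indicator) (auto simp: emeasure_cball)
  have "(cmod (fourier f \<xi>))\<^sup>2 \<le> B\<^sup>2 * indicator (cball 0 s) \<xi>
      + 1 / s ^ (2 * m) * ((1 + (norm \<xi>)\<^sup>2) ^ m * (cmod (fourier f \<xi>))\<^sup>2)" for \<xi>
  proof (cases "norm \<xi> \<le> s")
    case True
    then have "(cmod (fourier f \<xi>))\<^sup>2 \<le> B\<^sup>2" using B by (intro power_mono) auto
    then show ?thesis using True s by (simp add: add_increasing2)
  next
    case False
    then have "s\<^sup>2 \<le> 1 + (norm \<xi>)\<^sup>2" using s power_mono[of s "norm \<xi>" 2] by linarith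
    then have "s ^ (2 * m) \<le> (1 + (norm \<xi>)\<^sup>2) ^ m" using s unfolding power_mult by (intro power_mono) auto
    then have "1 \<le> 1 / s ^ (2 * m) * (1 + (norm \<xi>)\<^sup>2) ^ m" using s by (simp add: field_simps)
    then have "1 * (cmod (fourier f \<xi>))\<^sup>2 \<le> 1 / s ^ (2 * m) * (1 + (norm \<xi>)\<^sup>2) ^ m * (cmod (fourier f \<xi>))\<^sup>2"
      by (intro mult_right_mono) auto
    then show ?thesis using False by (simp add: mult.assoc)
  qed
  then have "(LINT \<xi>|lborel. (cmod (fourier f \<xi>))\<^sup>2) \<le> (LINT \<xi>|lborel. B\<^sup>2 * indicator (cball 0 s) \<xi>
      + 1 / s ^ (2 * m) * ((1 + (norm \<xi>)\<^sup>2) ^ m * (cmod (fourier f \<xi>))\<^sup>2))"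
    using ball int by (intro integral_mono Bochner_Integration.integrable_add integrable_mult_right[OF int(3)]) auto
  also have "\<dots> = B\<^sup>2 * measure lborel (cball 0 s :: (real^3) set)
      + 1 / s ^ (2 * m) * (LINT \<xi>|lborel. (1 + (norm \<xi>)\<^sup>2) ^ m * (cmod (fourier f \<xi>))\<^sup>2)"
    by (subst Bochner_Integration.integral_add[OF ball integrable_mult_right[OF int(3)]])
      (simp only: integral_mult_right_zero, simp)
  also have "measure lborel (cball 0 s :: (real^3) set) = unit_ball_vol 3 * s ^ 3"
    using s by (simp add: measure_def emeasure_cball)
  also have "1 / s ^ (2 * m) * (LINT \<xi>|lborel. (1 + (norm \<xi>)\<^sup>2) ^ m * (cmod (fourier f \<xi>))\<^sup>2)
      \<le> 1 / s ^ (2 * m) * ((2 * pi) ^ 3 * M\<^sup>2)"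
    using s by (intro mult_left_mono adm_class_weighted_integral_le[OF f]) auto
  finally have le: "(LINT \<xi>|lborel. (cmod (fourier f \<xi>))\<^sup>2)
      \<le> unit_ball_vol 3 * s ^ 3 * B\<^sup>2 + (2 * pi) ^ 3 * (M\<^sup>2 / s ^ (2 * m))"
    by (simp add: mult_ac)
  \<comment> \<open>The low-frequency term lacks the factor \<open>(2 * pi) ^ 3\<close> of
    Plancherel's identity; being at least 1, it may be inserted.\<close>
  have pi: "1 \<le> (2 * pi) ^ 3" using pi_gt3 by (intro one_le_power) auto
  have "0 \<le> unit_ball_vol 3 * s ^ 3 * B\<^sup>2" using s by simp
  then have "1 * (unit_ball_vol 3 * s ^ 3 * B\<^sup>2) \<le> (2 * pi) ^ 3 * (unit_ball_vol 3 * s ^ 3 * B\<^sup>2)"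
    using pi by (intro mult_right_mono)
  with le have "(LINT \<xi>|lborel. (cmod (fourier f \<xi>))\<^sup>2)
      \<le> (2 * pi) ^ 3 * (unit_ball_vol 3 * s ^ 3 * B\<^sup>2 + M\<^sup>2 / s ^ (2 * m))"
    by (simp only: distrib_left)
  then show ?thesis unfolding plancherel[OF int(1,2)] using pi by (simp add: divide_le_eq mult.commute)
qed

section \<open>Decay of the Fourier transform at a given frequency scale\<close>

text \<open>The exponent 12/11 is what \<open>K \<le> \<bar>ln \<epsilon>\<bar>\<close> yields for \<open>s = K powr (2/3) * \<bar>ln \<epsilon>\<bar> powr (1/4)\<close>;
  any exponent above 1 absorbs the loss \<open>exp (O(s ln s))\<close> of the extrapolation.\<close>

lemma fourier_decay_at_scale:
  fixes R \<delta> :: real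
  assumes R: "R \<ge> 1" and \<delta>: "\<delta> > 0"
  obtains S where "S \<ge> 1"
    and "\<And>s f x0 K \<xi>. \<lbrakk>s \<ge> S; x0 \<in> sphere 0 1; K > 1; integrable lborel f; {x. f x \<noteq> 0} \<subseteq> ball 0 R;
      ff_sup f x0 \<delta> K \<le> exp (- (s powr (12/11))); norm \<xi> \<le> s\<rbrakk>
      \<Longrightarrow> cmod (fourier f \<xi>) \<le> (1 + (LINT y|lborel. cmod (f y))) * exp (- s)"
proof -
  define r where "r = min (1/4) (\<delta>/8)"
  have r: "0 < r" "r \<le> 1/4" using \<delta> by (auto simp: r_def)
  \<comment> \<open>\<open>a\<close> and \<open>b\<close> are such that
    \<open>N + 1 <= a * s\<close> and \<open>ln (2 * m) <= b + 2 * ln s\<close> for the parameters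
    \<open>N\<close> and \<open>m\<close> chosen below.\<close>
  define a where "a = 14 * R"
  define b where "b = ln (54 * R / r)"
  have a: "a > 0" using R by (simp add: a_def)
  have "eventually (\<lambda>s. a * s * (b + 2 * ln s) - s powr (12/11) \<le> - s) at_top"
    using a by real_asymp
  then obtain S0 where S0: "\<And>s. s \<ge> S0 \<Longrightarrow> a * s * (b + 2 * ln s) - s powr (12/11) \<le> - s"
    by (auto simp: eventually_at_top_linorder)
  have ceil_le: "real (nat \<lceil>x\<rceil>) \<le> x + 1" if "x \<ge> 0" for x
  proof -
    have "real (nat \<lceil>x\<rceil>) = real_of_int \<lceil>x\<rceil>" using that by simp
    then show ?thesis using ceiling_correct[of x] by linarith
  qed
  show thesis
  proof (rule that[of "max 1 S0"])
    fix s K :: real and f and x0 \<xi> :: "real^3"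
    assume s: "s \<ge> max 1 S0" and x0: "x0 \<in> sphere 0 1" and K: "K > 1" and f: "integrable lborel f"
      and supp: "{x. f x \<noteq> 0} \<subseteq> ball 0 R" and small: "ff_sup f x0 \<delta> K \<le> exp (- (s powr (12/11)))"
      and \<xi>: "norm \<xi> \<le> s"
    have s1: "s \<ge> 1" using s by simp
    \<comment> \<open>The extrapolation starts at \<open>x0 /\<^sub>R 2\<close>, of norm 1/2, so
      \<open>T\<close> bounds the distance to \<xi>. As \<open>exp 1 <= 3\<close>, the choice
      \<open>N >= 6 * (R * T)\<close> pushes the tail below \<open>exp (- s)\<close>, and
      \<open>m\<close> is the least number with \<open>N * T <= m * r\<close>.\<close>
    define T where "T = s + 1"
    define N where "N = nat \<lceil>6 * (R * T)\<rceil>"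
    define m where "m = nat \<lceil>real N * T / r\<rceil>"
    have T: "T \<ge> 1" "T \<le> 2 * s" using s1 by (auto simp: T_def)
    have RT: "R * T \<ge> s" using mult_mono[of 1 R s T] R s1 by (simp add: T_def)
    have Rs: "R * s \<ge> 1" using mult_mono[of 1 R 1 s] R s1 by simp
    have N: "real N \<ge> 6 * (R * T)" unfolding N_def by (rule real_nat_ceiling_ge)
    have "real N \<le> 6 * (R * T) + 1"
      unfolding N_def using R T by (intro ceil_le) auto
    also have "\<dots> \<le> 13 * (R * s)"
    proof -
      have "R * T \<le> R * (2 * s)" using T(2) R by (intro mult_left_mono) auto
      then show ?thesis using Rs by linarith
    qed
    finally have N_le: "real N \<le> 13 * (R * s)" .
    have N1: "real N \<ge> 1" using N RT s1 by simp
    have m: "real m \<ge> real N * T / r" unfolding m_def by (rule real_nat_ceiling_ge)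
    have mr: "real N * T \<le> real m * r" using m r by (simp add: field_simps)
    have "real N * 1 \<le> real N * (T / r)" using T r by (intro mult_left_mono) (auto simp: field_simps)
    then have Nm: "real N \<le> real m" using m by simp
    have "real m \<le> real N * T / r + 1"
      unfolding m_def using N1 T r by (intro ceil_le) auto
    also have "\<dots> \<le> 13 * (R * s) * (2 * s) / r + 1"
      using N_le T r R s1 by (intro add_mono divide_right_mono mult_mono) auto
    also have "\<dots> \<le> 27 * R / r * s\<^sup>2"
    proof -
      have "1 * 1 \<le> (R / r) * s\<^sup>2" using R r s1 by (intro mult_mono) (auto simp: field_simps)
      then show ?thesis by (simp add: power2_eq_square)
    qed
    finally have m_le: "2 * real m \<le> 54 * R / r * s\<^sup>2" by simp
    have m1: "real m \<ge> 1" using Nm N1 by simp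
    \<comment> \<open>The prefactor \<open>N\<close> is absorbed as one more power of
      \<open>2 * m\<close>.\<close>
    have "real N * (2 * real m) ^ N \<le> (2 * real m) * (2 * real m) ^ N"
      using Nm by (intro mult_right_mono) auto
    also have "\<dots> = exp (real (Suc N) * ln (2 * real m))"
      using m1 by (subst exp_of_nat_mult) simp
    also have "\<dots> \<le> exp (a * s * (b + 2 * ln s))"
    proof -
      have "ln (2 * real m) \<le> ln (54 * R / r * s\<^sup>2)" using m_le m1 by (intro ln_mono) auto
      also have "\<dots> = b + 2 * ln s"
        using R r s1 unfolding b_def by (subst ln_mult) (auto simp: ln_realpow)
      finally have "ln (2 * real m) \<le> b + 2 * ln s" .
      moreover have "real (Suc N) \<le> a * s" using N_le Rs by (simp add: a_def)
      ultimately show ?thesis using m1 a s1 by (simp, intro mult_mono) auto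
    qed
    finally have grow: "real N * (2 * real m) ^ N \<le> exp (a * s * (b + 2 * ln s))" .
    have small': "cmod (fourier f \<eta>) \<le> exp (- (s powr (12/11)))" if "\<eta> \<in> ball (x0 /\<^sub>R 2) r" for \<eta>
      using fourier_le_ff_sup[OF x0 that[unfolded r_def] K, of f] small by simp
    have dist: "norm (\<xi> - x0 /\<^sub>R 2) \<le> T"
      using norm_triangle_ineq4[of \<xi> "x0 /\<^sub>R 2"] \<xi> x0 by (simp add: T_def)
    have "cmod (fourier f \<xi>) \<le> exp (- (s powr (12/11))) * (real N * (2 * real m) ^ N)
        + exp (exp 1 * (R * T) - real N) * (LINT y|lborel. cmod (f y))"
      using T R Nm m1 by (intro fourier_extrapolation[OF f supp small' _ dist _ mr]) auto
    also have "\<dots> \<le> exp (- s) + exp (- s) * (LINT y|lborel. cmod (f y))"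
    proof (intro add_mono mult_right_mono)
      have "exp (- (s powr (12/11))) * (real N * (2 * real m) ^ N)
          \<le> exp (- (s powr (12/11))) * exp (a * s * (b + 2 * ln s))"
        using grow by (intro mult_left_mono) auto
      also have "\<dots> = exp (a * s * (b + 2 * ln s) - s powr (12/11))" by (simp flip: exp_add)
      also have "\<dots> \<le> exp (- s)" using S0 s by simp
      finally show "exp (- (s powr (12/11))) * (real N * (2 * real m) ^ N) \<le> exp (- s)" .
      have "exp 1 * (R * T) \<le> 3 * (R * T)" using exp_le R T by (intro mult_right_mono) auto
      then show "exp (exp 1 * (R * T) - real N) \<le> exp (- s)" using N RT s1 by simp
    qed auto
    finally show "cmod (fourier f \<xi>) \<le> (1 + (LINT y|lborel. cmod (f y))) * exp (- s)"
      by (simp add: algebra_simps)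
  qed simp
qed

section \<open>Stability estimate from the decay at scale \<open>s\<close>\<close>

lemma power_le_fact_exp:
  fixes s :: real
  assumes "s \<ge> 0"
  shows "s ^ k \<le> fact k * exp s"
proof -
  have "(\<Sum>j\<in>{k}. s ^ j /\<^sub>R fact j) \<le> exp s"
    by (subst sums_unique[OF exp_converges], intro sum_le_suminf summable_exp_generic) (use assms in auto)
  then show ?thesis by (simp add: field_simps)
qed

text \<open>The low frequencies contribute a multiple of \<open>s ^ 3 * exp (- 2 * s)\<close>, which
  is smaller than any negative power of \<open>s\<close>; the Sobolev tail carries the exponent
  \<open>4 * n + 2\<close>, larger than \<open>4 * n - 3\<close>.\<close>

lemma L2_norm_sq_le_at_scale:
  fixes R \<delta> M :: real and n :: nat
  assumes R: "R \<ge> 1" and \<delta>: "\<delta> > 0" and n: "n \<ge> 1"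
  obtains S C where "S \<ge> 1" "C > 0"
    and "\<And>s f x0 K. \<lbrakk>s \<ge> S; x0 \<in> sphere 0 1; K > 1; f \<in> adm_class R M (2 * n + 1);
      ff_sup f x0 \<delta> K \<le> exp (- (s powr (12/11)))\<rbrakk> \<Longrightarrow> L2_norm_sq f \<le> C / s ^ (4 * n - 3)"
proof -
  obtain S where S: "S \<ge> 1" and decay: "\<And>s f x0 K \<xi>. \<lbrakk>s \<ge> S; x0 \<in> sphere 0 1; K > 1; integrable lborel f;
      {x. f x \<noteq> 0} \<subseteq> ball 0 R; ff_sup f x0 \<delta> K \<le> exp (- (s powr (12/11))); norm \<xi> \<le> s\<rbrakk>
      \<Longrightarrow> cmod (fourier f \<xi>) \<le> (1 + (LINT y|lborel. cmod (f y))) * exp (- s)"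
    using fourier_decay_at_scale[OF R \<delta>] by blast
  \<comment> \<open>\<open>A\<close> bounds 1 plus the L1 norm of every admissible \<open>f\<close>,
    through \<open>L1_norm_le\<close> and \<open>adm_class_L2_norm_sq_le\<close>.\<close>
  define A where "A = 1 + (unit_ball_vol 3 * R ^ 3 + M\<^sup>2)"
  define C where "C = unit_ball_vol 3 * A\<^sup>2 * fact (4 * n) + M\<^sup>2 + 1"
  have C: "C > 0" unfolding C_def by (intro add_nonneg_pos add_nonneg_nonneg) auto
  show thesis
  proof (rule that[OF S C])
    fix s K :: real and f x0
    assume s: "s \<ge> S" and x0: "x0 \<in> sphere 0 1" and K: "K > 1" and f: "f \<in> adm_class R M (2 * n + 1)"
      and small: "ff_sup f x0 \<delta> K \<le> exp (- (s powr (12/11)))"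
    have s1: "s \<ge> 1" using s S by simp
    have R0: "R \<ge> 0" and m: "2 * n + 1 \<ge> 3" using R n by auto
    have supp: "{x. f x \<noteq> 0} \<subseteq> ball 0 R" and L2: "L2_fun f" using f by (auto simp: adm_class_def in_H_def)
    have "1 + (LINT y|lborel. cmod (f y)) \<le> A"
      using L1_norm_le[OF L2 supp R0] adm_class_L2_norm_sq_le[OF f R0 m] by (simp add: A_def)
    then have "cmod (fourier f \<xi>) \<le> A * exp (- s)" if "norm \<xi> \<le> s" for \<xi>
      using decay[OF s x0 K adm_class_integrable(1)[OF f R0 m] supp small that]
      by (meson exp_ge_zero mult_right_mono order_trans)
    then have "L2_norm_sq f \<le> unit_ball_vol 3 * s ^ 3 * (A * exp (- s))\<^sup>2 + M\<^sup>2 / s ^ (2 * (2 * n + 1))"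
      using s1 by (intro L2_norm_sq_split[OF f R0 m]) auto
    also have "\<dots> \<le> unit_ball_vol 3 * A\<^sup>2 * (fact (4 * n) / s ^ (4 * n - 3)) + M\<^sup>2 / s ^ (4 * n - 3)"
    proof (intro add_mono)
      \<comment> \<open>Since \<open>4 * n = 3 + (4 * n - 3)\<close>, one bound on
        \<open>s ^ (4 * n)\<close> absorbs the volume factor and yields the required power.\<close>
      have "s ^ (4 * n) * (exp (- s))\<^sup>2 \<le> fact (4 * n) * exp s * (exp (- s))\<^sup>2"
        using s1 power_le_fact_exp[of s "4 * n"] by (intro mult_right_mono) auto
      also have "\<dots> = fact (4 * n) * exp (- s)" by (simp add: power2_eq_square mult.assoc flip: exp_add)
      also have "\<dots> \<le> fact (4 * n) * 1" using s1 by (intro mult_left_mono) auto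
      finally have "s ^ (4 * n) * (exp (- s))\<^sup>2 \<le> fact (4 * n)" by simp
      moreover have "s ^ (4 * n) = s ^ 3 * s ^ (4 * n - 3)" using n by (simp flip: power_add)
      ultimately have "s ^ 3 * (exp (- s))\<^sup>2 \<le> fact (4 * n) / s ^ (4 * n - 3)"
        using s1 by (simp add: field_simps)
      then have "(unit_ball_vol 3 * A\<^sup>2) * (s ^ 3 * (exp (- s))\<^sup>2)
          \<le> (unit_ball_vol 3 * A\<^sup>2) * (fact (4 * n) / s ^ (4 * n - 3))"
        by (intro mult_left_mono) auto
      then show "unit_ball_vol 3 * s ^ 3 * (A * exp (- s))\<^sup>2
          \<le> unit_ball_vol 3 * A\<^sup>2 * (fact (4 * n) / s ^ (4 * n - 3))"
        by (simp add: power_mult_distrib mult_ac)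
      show "M\<^sup>2 / s ^ (2 * (2 * n + 1)) \<le> M\<^sup>2 / s ^ (4 * n - 3)"
        using s1 by (intro divide_left_mono power_increasing) auto
    qed
    also have "\<dots> = (unit_ball_vol 3 * A\<^sup>2 * fact (4 * n) + M\<^sup>2) / s ^ (4 * n - 3)"
      by (simp add: add_divide_distrib)
    also have "\<dots> \<le> C / s ^ (4 * n - 3)"
      using s1 by (intro divide_right_mono) (auto simp: C_def)
    finally show "L2_norm_sq f \<le> C / s ^ (4 * n - 3)" .
  qed
qed

theorem theorem1:
  fixes R \<delta> :: real
  assumes "R \<ge> 1" and "\<delta> > 0"
  shows "\<exists>\<alpha>. 0 < \<alpha> \<and> \<alpha> < 1 \<and>
    (\<forall>M (n::nat) (x0::real^3). M > 1 \<and> n \<ge> 1 \<and> x0 \<in> sphere 0 1 \<longrightarrow>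
      (\<exists>C>0. \<forall>K f. K > 1 \<and> f \<in> adm_class R M (2 * n + 1) \<and> ff_sup f x0 \<delta> K < 1 \<longrightarrow>
         L2_norm_sq f \<le> C * (K ^ 3 * exp (2 * K * (1 - \<alpha>)) * ff_sup f x0 \<delta> K powr (2 * \<alpha>)
            + M\<^sup>2 / (K powr (2 / 3) * \<bar>ln (ff_sup f x0 \<delta> K)\<bar> powr (1 / 4)) ^ (4 * n - 3))))"
proof (rule exI[of _ "1/2"], intro conjI allI impI)
  fix M :: real and n :: nat and x0 :: "real^3"
  assume "M > 1 \<and> n \<ge> 1 \<and> x0 \<in> sphere 0 1"
  then have M: "M > 1" and n: "n \<ge> 1" and x0: "x0 \<in> sphere 0 1" by auto
  let ?k = "4 * n - 3"
  have k: "?k \<ge> 1" using n by simp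
  have R0: "R \<ge> 0" and m: "2 * n + 1 \<ge> 3" using assms n by auto
  obtain S C where S: "S \<ge> 1" and C: "C > 0"
    and scale: "\<And>s f x0 K. \<lbrakk>s \<ge> S; x0 \<in> sphere 0 1; K > 1; f \<in> adm_class R M (2 * n + 1);
      ff_sup f x0 \<delta> K \<le> exp (- (s powr (12/11)))\<rbrakk> \<Longrightarrow> L2_norm_sq f \<le> C / s ^ ?k"
    using L2_norm_sq_le_at_scale[OF assms n] by blast
  \<comment> \<open>One summand per case: \<open>M\<^sup>2\<close> for \<open>L <= K\<close>,
    \<open>C\<close> for \<open>s >= S\<close>, and the power of \<open>S\<close> for
    \<open>s < S\<close>.\<close>
  define D where "D = C + S ^ ?k + M\<^sup>2"
  have D: "D \<ge> C" "D \<ge> S ^ ?k" "D \<ge> M\<^sup>2" "D > 0"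
    using C S zero_le_power[of S ?k] zero_le_power2[of M] unfolding D_def by linarith+
  show "\<exists>C>0. \<forall>K f. K > 1 \<and> f \<in> adm_class R M (2 * n + 1) \<and> ff_sup f x0 \<delta> K < 1 \<longrightarrow>
         L2_norm_sq f \<le> C * (K ^ 3 * exp (2 * K * (1 - 1/2)) * ff_sup f x0 \<delta> K powr (2 * (1/2))
            + M\<^sup>2 / (K powr (2 / 3) * \<bar>ln (ff_sup f x0 \<delta> K)\<bar> powr (1 / 4)) ^ ?k)"
  proof (intro exI[of _ D] conjI allI impI D)
    fix K :: real and f
    define \<epsilon> where "\<epsilon> = ff_sup f x0 \<delta> K"
    define L where "L = - ln \<epsilon>"
    define s where "s = K powr (2 / 3) * \<bar>ln \<epsilon>\<bar> powr (1 / 4)"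
    assume "K > 1 \<and> f \<in> adm_class R M (2 * n + 1) \<and> ff_sup f x0 \<delta> K < 1"
    then have K: "K > 1" and f: "f \<in> adm_class R M (2 * n + 1)" and \<epsilon>1: "\<epsilon> < 1" by (auto simp: \<epsilon>_def)
    have L2_le: "L2_norm_sq f \<le> M\<^sup>2" by (rule adm_class_L2_norm_sq_le[OF f R0 m])
    \<comment> \<open>The supremum dominates a modulus, that of the transform at the centre of the
      ball, so it is nonnegative.\<close>
    have "x0 /\<^sub>R 2 \<in> ball (x0 /\<^sub>R 2) (min (1/4) (\<delta>/8))" using assms by simp
    from order_trans[OF norm_ge_zero fourier_le_ff_sup[OF x0 this K]]
    have \<epsilon>0: "\<epsilon> \<ge> 0" unfolding \<epsilon>_def .
    \<comment> \<open>At \<alpha> = 1/2 the exponents \<open>2 * K * (1 - \<alpha>)\<close> and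
      \<open>2 * \<alpha>\<close> become \<open>K\<close> and 1.\<close>
    have "L2_norm_sq f \<le> D * (K ^ 3 * exp K * \<epsilon> + M\<^sup>2 / s ^ ?k)"
    proof (cases "\<epsilon> = 0")
      case True
      have "L2_norm_sq f \<le> 0"
      proof (rule ccontr)
        assume "\<not> L2_norm_sq f \<le> 0"
        then have pos: "L2_norm_sq f > 0" by simp
        \<comment> \<open>With \<epsilon> = 0 every scale from \<open>S\<close> on is admissible;
          this one makes \<open>C / s'\<close> smaller than the supposedly positive norm.\<close>
        define s' where "s' = max S (C / L2_norm_sq f + 1)"
        have s': "s' \<ge> S" "s' \<ge> 1" "s' > C / L2_norm_sq f" using S by (auto simp: s'_def)
        have "L2_norm_sq f \<le> C / s' ^ ?k"
          using True by (intro scale[OF s'(1) x0 K f]) (simp add: \<epsilon>_def)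
        also have "\<dots> \<le> C / s' ^ 1" using s' C k by (intro divide_left_mono power_increasing) auto
        also have "\<dots> < L2_norm_sq f" using s' pos by (simp add: field_simps)
        finally show False by simp
      qed
      \<comment> \<open>Here \<open>s = 0\<close>, and as the exponent is at least 1 the denominator
        is 0 as well.\<close>
      then show ?thesis using True k by (simp add: s_def zero_power)
    next
      case False
      then have \<epsilon>: "\<epsilon> > 0" using \<epsilon>0 by simp
      have \<epsilon>_eq: "\<epsilon> = exp (- L)" using \<epsilon> by (simp add: L_def)
      have L: "L > 0" using \<epsilon> \<epsilon>1 by (simp add: L_def)
      have s_eq: "s = K powr (2/3) * L powr (1/4)" using L by (simp add: s_def L_def)
      have s: "s > 0" using K L by (simp add: s_eq)
      show ?thesis
      proof (cases "L \<le> K")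
        case True
        \<comment> \<open>In this case \<epsilon> = \<open>exp (- L)\<close> is at least
          \<open>exp (- K)\<close>.\<close>
        have "1 * 1 \<le> K ^ 3 * exp (K - L)" using True K by (intro mult_mono one_le_power) auto
        also have "\<dots> = K ^ 3 * exp K * \<epsilon>" by (simp add: \<epsilon>_eq exp_diff exp_minus divide_inverse)
        also have "\<dots> \<le> K ^ 3 * exp K * \<epsilon> + M\<^sup>2 / s ^ ?k" using s by simp
        finally have "D * 1 \<le> D * (K ^ 3 * exp K * \<epsilon> + M\<^sup>2 / s ^ ?k)" using D by (intro mult_left_mono) auto
        then show ?thesis using L2_le D(3) by linarith
      next
        case KL: False
        \<comment> \<open>The exponents add up to 11/12, the reciprocal of the exponent in
          \<open>scale\<close>.\<close>
        have "s \<le> L powr (2/3) * L powr (1/4)"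
          unfolding s_eq using KL K by (intro mult_right_mono powr_mono2) auto
        also have "\<dots> = L powr (11/12)" by (simp flip: powr_add)
        finally have "s powr (12/11) \<le> (L powr (11/12)) powr (12/11)" using s by (intro powr_mono2) auto
        also have "\<dots> = L" using L by (simp add: powr_powr)
        finally have small: "ff_sup f x0 \<delta> K \<le> exp (- (s powr (12/11)))"
          unfolding \<epsilon>_def[symmetric] \<epsilon>_eq by simp
        have "L2_norm_sq f \<le> D * (M\<^sup>2 / s ^ ?k)"
        proof (cases "s \<ge> S")
          case True
          have "L2_norm_sq f \<le> C / s ^ ?k" by (rule scale[OF True x0 K f small])
          also have "\<dots> \<le> D * M\<^sup>2 / s ^ ?k"
          proof -
            have "C * 1 \<le> D * M\<^sup>2" using D M C by (intro mult_mono one_le_power) auto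
            then show ?thesis using s by (simp add: divide_right_mono)
          qed
          finally show ?thesis by simp
        next
          case False
          \<comment> \<open>Below the threshold \<open>S\<close> the ratio of \<open>D\<close> to
            the denominator is at least 1, and the trivial bound \<open>M\<^sup>2\<close>
            suffices.\<close>
          then have "s ^ ?k \<le> D" using s D(2) power_mono[of s S ?k] by simp
          then have "M\<^sup>2 * 1 \<le> M\<^sup>2 * (D / s ^ ?k)" using s by (intro mult_left_mono) auto
          then show ?thesis using L2_le by (simp add: mult_ac)
        qed
        also have "\<dots> \<le> D * (K ^ 3 * exp K * \<epsilon> + M\<^sup>2 / s ^ ?k)"
          using D K \<epsilon> by (intro mult_left_mono) auto
        finally show ?thesis .
      qed
    qed
    then show "L2_norm_sq f \<le> D * (K ^ 3 * exp (2 * K * (1 - 1/2)) * ff_sup f x0 \<delta> K powr (2 * (1/2))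
            + M\<^sup>2 / (K powr (2 / 3) * \<bar>ln (ff_sup f x0 \<delta> K)\<bar> powr (1 / 4)) ^ ?k)"
      using \<epsilon>0 by (simp add: s_def \<epsilon>_def)
  qed
qed auto

end
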